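(* With $z_2$, $z_{\mathrm{SL}}$, $z_{\mathrm{RL}}$ the second-order, signed and recursive-line Zarankiewicz parameters, $$z_2(5,5)=z_{\mathrm{SL}}(5,5)=z_{\mathrm{RL}}(5,5)=17.$$
   Context: Configurations. Fix $m,n\ge1$. Identify the cell $(i,j)$ (row $i$, column $j$) of the $m\times n$ grid with the monomial $u_{ij}=x_iy_j$ in real variables $x_1,\dots,x_m,y_1,\dots,y_n$. A bilinear form is a real linear combination of the $u_{ij}$. If $P$ is a sum of squares of real bilinear forms, $\mathrm{SOS}(P)$ is the least number of squares in such a representation. A one-edge is a single cell; a two-edge is an unordered pair of two distinct cells (possibly in a common row or column). An augmented configuration $G$ consists of a set $E_1$ of one-edges and a set $E_2$ of two-edges, together called the selected edges; $G$ is simple if distinct selected edges have disjoint supports (sets of cells). Put $P_G=\sum_{(i,j)\in E_1}u_{ij}^2+\sum_{\{(i,j),(k,\ell)\}\in E_2}(u_{ij}+u_{k\ell})^2$ and $R(G)=|E_1|+|E_2|$ (number of displayed squares). $G$ is irreducible if $\mathrm{SOS}(P_G)=R(G)$. $z(m,n)$ is the maximum number of edges of a $C_4$-free bipartite graph with parts $[m]$ (rows) and $[n]$ (columns), i.e. of a set of cells containing no four corners of two rows and two columns. $G$ is limited if it is simple, $E_1$ is $C_4$-free and $|E_1|=z(m,n)$. $z_2(m,n)$ is the maximum of $R(G)$ over irreducible limited $m\times n$ configurations. The condition $(RW3^+)$. For a simple $G$ let $\Omega$ be the set of cells occupied by selected edges, and for distinct cells let $\delta(p,q)=1$ if $\{p,q\}\in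 E_2$ and $0$ otherwise. A genuine rectangle is given by two distinct rows and two distinct columns; its two diagonals are the two pairs of opposite corners. Let $\sim$ (an equivalence relation on $\Omega$) and $\perp_R$ (a symmetric relation on $\Omega$) be the least relations closed under: (1) Line rule: if distinct $p,q\in\Omega$ lie in a common row or column, then $p\sim q$ if $\delta(p,q)=1$ and $p\perp_R q$ if $\delta(p,q)=0$. (2) Saturation: if $p\sim p'$, $q\sim q'$, $p'\perp_R q'$ then $p\perp_R q$. (3) Rectangle transfer: let $\{p,q\},\{r,s\}$ be the two diagonals of a genuine rectangle and suppose $\{r,s\}$ is certified, meaning: if $\delta(r,s)=0$, then at least one of $r,s$ is unoccupied or ($r,s\in\Omega$ and $r\perp_R s$); if $\delta(r,s)=1$, then $r\sim s$. Then: if $p,q\in\Omega$ and $\delta(p,q)=0$, $p\perp_R q$; if $\delta(p,q)=1$, $p\sim q$. (4) Complementary pair: if both diagonals $\{p,q\},\{r,s\}$ of a genuine rectangle are in $E_2$, then $p\sim q$ and $r\sim s$. $G$ is $(RW3^+)$-admissible if the two halves of every selected two-edge are $\sim$-equivalent, distinct selected edges lie in distinct $\sim$-classes, and every two distinct selected edges have representatives $p,q$ with $p\perp_R q$. $z_{\mathrm{RL}}(m,n)$ is the maximum of $R(G)$ over limited $(RW3^+)$-admissible $m\times n$ configurations. The parameter $z_{\mathrm{SL}}(m,n)$ is defined analogously to $z_{\mathrm{RL}}$ with a signed condition $(RW3^{\pm})$ from the literature (Löfberg–Qi) in place of $(RW3^+)$; the only property of it to be used is the established hierarchy $z_2(m,n)\ge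 z_{\mathrm{SL}}(m,n)\ge z_{\mathrm{RL}}(m,n)$, so it may be treated as any integer satisfying these inequalities. *)

theory Defs
  imports Complex_Main
begin

type_synonym cell = "nat \<times> nat"

definition cells :: "nat \<Rightarrow> nat \<Rightarrow> cell set" where
  "cells m n = {1..m} \<times> {1..n}"

record configuration =
  one_edges :: "cell set"
  two_edges :: "cell set set"

definition augmented_configuration :: "nat \<Rightarrow> nat \<Rightarrow> configuration \<Rightarrow> bool" where
  "augmented_configuration m n G \<longleftrightarrow>
     one_edges G \<subseteq> cells m n \<and> (\<forall>e\<in>two_edges G. e \<subseteq> cells m n \<and> card e = 2)"

text \<open>A selected edge is represented by its support, so one-edges become singletons.\<close>

definition selected_edges :: "configuration \<Rightarrow> cell set set" where
  "selected_edges G = (\<lambda>c. {c}) ` one_edges G \<union> two_edges G"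

definition simple_configuration :: "configuration \<Rightarrow> bool" where
  "simple_configuration G \<longleftrightarrow>
     (\<forall>e\<in>selected_edges G. \<forall>f\<in>selected_edges G. e \<noteq> f \<longrightarrow> e \<inter> f = {})"

definition num_squares :: "configuration \<Rightarrow> nat" where
  "num_squares G = card (one_edges G) + card (two_edges G)"

text \<open>
  Real polynomials in the variables \<open>x\<^sub>1, \<dots>, x\<^sub>m, y\<^sub>1, \<dots>, y\<^sub>n\<close> are represented by the functions
  they induce; since the reals are infinite, equality of such functions is equality of
  polynomials. The points are sequences, of which only the entries \<open>x i\<close> with \<open>1 \<le> i \<le> m\<close>
  and \<open>y j\<close> with \<open>1 \<le> j \<le> n\<close> occur.
\<close>

type_synonym form = "(nat \<Rightarrow> real) \<Rightarrow> (nat \<Rightarrow> real) \<Rightarrow> real"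

definition monomial :: "cell \<Rightarrow> form" where
  "monomial c x y = x (fst c) * y (snd c)"

definition bilinear_form :: "nat \<Rightarrow> nat \<Rightarrow> form \<Rightarrow> bool" where
  "bilinear_form m n f \<longleftrightarrow>
     (\<exists>a :: cell \<Rightarrow> real. \<forall>x y. f x y = (\<Sum>c\<in>cells m n. a c * monomial c x y))"

definition sum_of_bilinear_squares :: "nat \<Rightarrow> nat \<Rightarrow> nat \<Rightarrow> form \<Rightarrow> bool" where
  "sum_of_bilinear_squares m n k P \<longleftrightarrow>
     (\<exists>f :: nat \<Rightarrow> form. (\<forall>t<k. bilinear_form m n (f t)) \<and>
        (\<forall>x y. P x y = (\<Sum>t<k. (f t x y)\<^sup>2)))"

text \<open>Unspecified unless \<open>P\<close> is a sum of squares of bilinear forms.\<close>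

definition SOS :: "nat \<Rightarrow> nat \<Rightarrow> form \<Rightarrow> nat" where
  "SOS m n P = (LEAST k. sum_of_bilinear_squares m n k P)"

definition config_form :: "configuration \<Rightarrow> form" where
  "config_form G x y =
     (\<Sum>c\<in>one_edges G. (monomial c x y)\<^sup>2) +
     (\<Sum>e\<in>two_edges G. (\<Sum>c\<in>e. monomial c x y)\<^sup>2)"

definition irreducible_configuration :: "nat \<Rightarrow> nat \<Rightarrow> configuration \<Rightarrow> bool" where
  "irreducible_configuration m n G \<longleftrightarrow> SOS m n (config_form G) = num_squares G"

definition C4_free :: "cell set \<Rightarrow> bool" where
  "C4_free E \<longleftrightarrow>
     \<not> (\<exists>i k j l. i \<noteq> k \<and> j \<noteq> l \<and> {(i, j), (i, l), (k, j), (k, l)} \<subseteq> E)"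

definition zarankiewicz :: "nat \<Rightarrow> nat \<Rightarrow> nat" where
  "zarankiewicz m n = Max {card E | E. E \<subseteq> cells m n \<and> C4_free E}"

definition limited_configuration :: "nat \<Rightarrow> nat \<Rightarrow> configuration \<Rightarrow> bool" where
  "limited_configuration m n G \<longleftrightarrow>
     augmented_configuration m n G \<and> simple_configuration G \<and>
     C4_free (one_edges G) \<and> card (one_edges G) = zarankiewicz m n"

definition z2 :: "nat \<Rightarrow> nat \<Rightarrow> nat" where
  "z2 m n = Max {num_squares G | G.
     limited_configuration m n G \<and> irreducible_configuration m n G}"

definition occupied :: "configuration \<Rightarrow> cell set" where
  "occupied G = \<Union> (selected_edges G)"

definition paired :: "configuration \<Rightarrow> cell \<Rightarrow> cell \<Rightarrow> bool" where
  "paired G p q \<longleftrightarrow> {p, q} \<in> two_edges G"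

text \<open>
  \<open>rw_sim\<close> and \<open>rw_perp\<close> are the relations \<open>\<sim>\<close> and \<open>\<bottom>\<^sub>R\<close>; \<open>paired G p q\<close> says \<open>\<delta>(p,q) = 1\<close>.
  In the rectangle rules the diagonals are \<open>{(i,j), (k,l)}\<close> and \<open>{(i,l), (k,j)}\<close>; exchanging
  \<open>j\<close> and \<open>l\<close> exchanges the two diagonals, so each rule covers both of them.
\<close>

inductive rw_sim :: "configuration \<Rightarrow> cell \<Rightarrow> cell \<Rightarrow> bool"
  and rw_perp :: "configuration \<Rightarrow> cell \<Rightarrow> cell \<Rightarrow> bool"
  for G :: configuration
where
  sim_refl: "p \<in> occupied G \<Longrightarrow> rw_sim G p p"
| sim_sym: "rw_sim G p q \<Longrightarrow> rw_sim G q p"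
| sim_trans: "rw_sim G p q \<Longrightarrow> rw_sim G q r \<Longrightarrow> rw_sim G p r"
| perp_sym: "rw_perp G p q \<Longrightarrow> rw_perp G q p"
| line_sim:
    "p \<in> occupied G \<Longrightarrow> q \<in> occupied G \<Longrightarrow> p \<noteq> q \<Longrightarrow> fst p = fst q \<or> snd p = snd q \<Longrightarrow>
     paired G p q \<Longrightarrow> rw_sim G p q"
| line_perp:
    "p \<in> occupied G \<Longrightarrow> q \<in> occupied G \<Longrightarrow> p \<noteq> q \<Longrightarrow> fst p = fst q \<or> snd p = snd q \<Longrightarrow>
     \<not> paired G p q \<Longrightarrow> rw_perp G p q"
| saturation:
    "rw_sim G p p' \<Longrightarrow> rw_sim G q q' \<Longrightarrow> rw_perp G p' q' \<Longrightarrow> rw_perp G p q"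
| transfer_perp:
    "i \<noteq> k \<Longrightarrow> j \<noteq> l \<Longrightarrow>
     (\<not> paired G (i, l) (k, j) \<and>
        ((i, l) \<notin> occupied G \<or> (k, j) \<notin> occupied G \<or> rw_perp G (i, l) (k, j))) \<or>
     (paired G (i, l) (k, j) \<and> rw_sim G (i, l) (k, j)) \<Longrightarrow>
     (i, j) \<in> occupied G \<Longrightarrow> (k, l) \<in> occupied G \<Longrightarrow> \<not> paired G (i, j) (k, l) \<Longrightarrow>
     rw_perp G (i, j) (k, l)"
| transfer_sim:
    "i \<noteq> k \<Longrightarrow> j \<noteq> l \<Longrightarrow>
     (\<not> paired G (i, l) (k, j) \<and>
        ((i, l) \<notin> occupied G \<or> (k, j) \<notin> occupied G \<or> rw_perp G (i, l) (k, j))) \<or>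
     (paired G (i, l) (k, j) \<and> rw_sim G (i, l) (k, j)) \<Longrightarrow>
     paired G (i, j) (k, l) \<Longrightarrow>
     rw_sim G (i, j) (k, l)"
| complementary_pair:
    "i \<noteq> k \<Longrightarrow> j \<noteq> l \<Longrightarrow> paired G (i, j) (k, l) \<Longrightarrow> paired G (i, l) (k, j) \<Longrightarrow>
     rw_sim G (i, j) (k, l)"

definition RW3_plus_admissible :: "configuration \<Rightarrow> bool" where
  "RW3_plus_admissible G \<longleftrightarrow>
     (\<forall>e\<in>two_edges G. \<forall>p\<in>e. \<forall>q\<in>e. rw_sim G p q) \<and>
     (\<forall>e\<in>selected_edges G. \<forall>f\<in>selected_edges G. e \<noteq> f \<longrightarrow>
        (\<forall>p\<in>e. \<forall>q\<in>f. \<not> rw_sim G p q) \<and>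
        (\<exists>p\<in>e. \<exists>q\<in>f. rw_perp G p q))"

definition z_RL :: "nat \<Rightarrow> nat \<Rightarrow> nat" where
  "z_RL m n = Max {num_squares G | G.
     limited_configuration m n G \<and> RW3_plus_admissible G}"

end

theory Submission
  imports Defs "HOL-Combinatorics.List_Permutation"
begin

text \<open>
  A representation of \<open>P\<^sub>G\<close> by \<open>k\<close> squares assigns to every cell \<open>p\<close> the vector in \<open>\<real>\<^sup>k\<close> of its
  coefficients, and a family of such vectors represents \<open>P\<^sub>G\<close> iff the Gram matrix has the right sums
  over the two diagonals of every (possibly degenerate) rectangle. The rules of \<open>(RW3\<^sup>+)\<close> therefore
  derive equalities and orthogonalities of these vectors, so an admissible configuration has \<open>R(G)\<close>
  orthonormal vectors among them and is irreducible. One admissible configuration with 17 edges gives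
  the lower bounds.

  For the upper bound, \<open>z(5,5) = 12\<close> and the extremal \<open>C\<^sub>4\<close>-free sets are, up to permutations of rows and
  columns, the two sets given by \<open>rows_A\<close> and \<open>rows_B\<close>. With 18 edges, six two-edges would cover all but
  one of the remaining 13 cells. Thirteen small groups of edges have a sum of squares that can be
  written with fewer squares, and every almost perfect matching of the 13 cells contains one of them.
\<close>

section \<open>Sums of squares of bilinear forms\<close>

text \<open>The coefficient of \<open>x_i x_k y_j y_l\<close> in a sum of squares sees only the sum
  of the inner products over both diagonals of a rectangle. A single inner product is therefore
  forced on a line, or once the opposite diagonal is known, which is what a certificate records.
  Inner products turn into equalities of vectors because occupied cells have unit vectors, and two
  unit vectors with inner product 1 coincide.

  In the other direction, failure of irreducibility is local: a few squares that can be rewritten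
  with fewer spoil the whole configuration. The one-edges of a suitably placed pattern are present
  anyway, so each placement just forbids a set of two-edges. There are 135135 ways to choose six
  disjoint pairs among 13 cells; instead of enumerating them, the conditions are written as clauses
  about the 78 possible pairs and refuted propositionally.

  Since admissible configurations are irreducible, one upper bound serves both \<open>z2\<close> and
  \<open>z_RL\<close>, and the signed parameter is squeezed between them.\<close>

definition edge_squares :: "cell list list \<Rightarrow> form" where
  "edge_squares P x y = (\<Sum>p\<leftarrow>P. (\<Sum>c\<leftarrow>p. monomial c x y)\<^sup>2)"

definition reducible :: "nat \<Rightarrow> nat \<Rightarrow> cell list list \<Rightarrow> bool" where
  "reducible m n P \<longleftrightarrow> (\<exists>k<length P. sum_of_bilinear_squares m n k (edge_squares P))"

definition linear_combination :: "(real \<times> cell) list \<Rightarrow> form" where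
  "linear_combination ts x y = (\<Sum>(a, c)\<leftarrow>ts. a * monomial c x y)"

lemma finite_cells [simp]: "finite (cells m n)"
  by (simp add: cells_def)

lemma bilinear_form_zero: "bilinear_form m n (\<lambda>x y. 0)"
  unfolding bilinear_form_def by (intro exI[of _ "\<lambda>c. 0"]) simp

lemma bilinear_form_monomial:
  assumes "c \<in> cells m n"
  shows "bilinear_form m n (\<lambda>x y. a * monomial c x y)"
  unfolding bilinear_form_def
proof (intro exI allI)
  fix x y
  have "(\<Sum>d\<in>cells m n. (if d = c then a else 0) * monomial d x y)
      = (\<Sum>d\<in>cells m n. if d = c then a * monomial c x y else 0)"
    by (rule sum.cong) auto
  also have "\<dots> = a * monomial c x y"
    using assms by simp
  finally show "a * monomial c x y = (\<Sum>d\<in>cells m n. (if d = c then a else 0) * monomial d x y)"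
    by simp
qed

lemma bilinear_form_add:
  assumes "bilinear_form m n f" "bilinear_form m n g"
  shows "bilinear_form m n (\<lambda>x y. f x y + g x y)"
proof -
  obtain a b where
    "\<And>x y. f x y = (\<Sum>c\<in>cells m n. a c * monomial c x y)"
    "\<And>x y. g x y = (\<Sum>c\<in>cells m n. b c * monomial c x y)"
    using assms unfolding bilinear_form_def by blast
  then show ?thesis
    unfolding bilinear_form_def
    by (intro exI[of _ "\<lambda>c. a c + b c"]) (simp add: distrib_right sum.distrib)
qed

lemma bilinear_form_linear_combination:
  assumes "\<forall>(a, c)\<in>set ts. c \<in> cells m n"
  shows "bilinear_form m n (linear_combination ts)"
  using assms
proof (induction ts)
  case Nil
  have "linear_combination [] = (\<lambda>x y. 0)"
    by (simp add: linear_combination_def fun_eq_iff)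
  then show ?case
    by (simp add: bilinear_form_zero)
next
  case (Cons t ts)
  obtain a c where t: "t = (a, c)"
    by (cases t)
  have "linear_combination (t # ts) = (\<lambda>x y. a * monomial c x y + linear_combination ts x y)"
    by (simp add: linear_combination_def fun_eq_iff t)
  then show ?case
    using Cons t by (simp add: bilinear_form_add bilinear_form_monomial)
qed

lemma bilinear_form_sum:
  assumes "finite e" "e \<subseteq> cells m n"
  shows "bilinear_form m n (\<lambda>x y. \<Sum>c\<in>e. monomial c x y)"
  using assms
  by (induction e rule: finite_induct)
    (auto intro!: bilinear_form_add bilinear_form_zero bilinear_form_monomial[where a = 1, simplified])

lemma sum_of_bilinear_squares_list:
  assumes "\<forall>f\<in>set fs. bilinear_form m n f" "\<And>x y. P x y = (\<Sum>f\<leftarrow>fs. (f x y)\<^sup>2)"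
  shows "sum_of_bilinear_squares m n (length fs) P"
  unfolding sum_of_bilinear_squares_def
  by (intro exI[of _ "\<lambda>t. fs ! t"])
    (use assms in \<open>auto simp: sum_list_sum_nth atLeast0LessThan\<close>)

lemma sum_of_bilinear_squares_add:
  assumes "sum_of_bilinear_squares m n k P" "sum_of_bilinear_squares m n l Q"
  shows "sum_of_bilinear_squares m n (k + l) (\<lambda>x y. P x y + Q x y)"
proof -
  obtain f g where f: "\<forall>t<k. bilinear_form m n (f t)" "\<And>x y. P x y = (\<Sum>t<k. (f t x y)\<^sup>2)"
    and g: "\<forall>t<l. bilinear_form m n (g t)" "\<And>x y. Q x y = (\<Sum>t<l. (g t x y)\<^sup>2)"
    using assms unfolding sum_of_bilinear_squares_def by blast
  let ?fs = "map f [0..<k] @ map g [0..<l]"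
  have "sum_of_bilinear_squares m n (length ?fs) (\<lambda>x y. P x y + Q x y)"
    by (rule sum_of_bilinear_squares_list)
      (use f g in \<open>auto simp: interv_sum_list_conv_sum_set_nat comp_def atLeast0LessThan\<close>)
  then show ?thesis
    by simp
qed

lemma sum_of_bilinear_squares_sum:
  assumes "finite F" "\<forall>e\<in>F. finite e \<and> e \<subseteq> cells m n"
  shows "sum_of_bilinear_squares m n (card F) (\<lambda>x y. \<Sum>e\<in>F. (\<Sum>c\<in>e. monomial c x y)\<^sup>2)"
proof -
  obtain es where es: "set es = F" "distinct es"
    using assms(1) finite_distinct_list by blast
  have "sum_of_bilinear_squares m n (length (map (\<lambda>e x y. \<Sum>c\<in>e. monomial c x y) es))
      (\<lambda>x y. \<Sum>e\<in>F. (\<Sum>c\<in>e. monomial c x y)\<^sup>2)"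
    by (rule sum_of_bilinear_squares_list)
      (use es assms in \<open>auto simp: comp_def sum_list_distinct_conv_sum_set intro!: bilinear_form_sum\<close>)
  then show ?thesis
    using es by (simp add: distinct_card[symmetric])
qed

lemma reducibleI:
  assumes "length ts < length P" "\<forall>t\<in>set ts. \<forall>(a, c)\<in>set t. c \<in> cells m n"
    and "\<And>x y. edge_squares P x y = (\<Sum>t\<leftarrow>ts. (linear_combination t x y)\<^sup>2)"
  shows "reducible m n P"
proof -
  have "sum_of_bilinear_squares m n (length (map linear_combination ts)) (edge_squares P)"
    by (rule sum_of_bilinear_squares_list)
      (use assms(2,3) in \<open>auto simp: comp_def intro!: bilinear_form_linear_combination\<close>)
  then show ?thesis
    using assms(1) unfolding reducible_def by auto
qed

text \<open>Substituting \<open>x \<circ> \<rho>\<close> for \<open>x\<close> and \<open>y \<circ> \<kappa>\<close> for \<open>y\<close> turns \<open>u\<^sub>i\<^sub>j\<close> into \<open>u\<close> at \<open>(\<rho> i, \<kappa> j)\<close>.\<close>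

lemma bilinear_form_substitute:
  assumes "bilinear_form m n f" "\<rho> ` {1..m} \<subseteq> {1..m'}" "\<kappa> ` {1..n} \<subseteq> {1..n'}"
  shows "bilinear_form m' n' (\<lambda>x y. f (x \<circ> \<rho>) (y \<circ> \<kappa>))"
proof -
  obtain a where a: "\<And>x y. f x y = (\<Sum>c\<in>cells m n. a c * monomial c x y)"
    using assms(1) unfolding bilinear_form_def by blast
  obtain cs where cs: "set cs = cells m n" "distinct cs"
    using finite_cells finite_distinct_list by blast
  have "(\<lambda>x y. f (x \<circ> \<rho>) (y \<circ> \<kappa>)) = linear_combination (map (\<lambda>c. (a c, map_prod \<rho> \<kappa> c)) cs)"
    using cs
    by (intro ext) (simp add: a linear_combination_def comp_def monomial_def
        sum_list_distinct_conv_sum_set)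
  moreover have "bilinear_form m' n' \<dots>"
    using assms(2,3) cs
    by (intro bilinear_form_linear_combination) (force simp: cells_def)
  ultimately show ?thesis
    by simp
qed

text \<open>Lists keep multiplicities, so the substitution acts on \<open>edge_squares\<close> term
  by term for any relabelling into the grid and preserves \<open>length P\<close>. Distinctness
  enters when a list is compared with a configuration.\<close>

lemma reducible_map:
  assumes "reducible m n P" "\<rho> ` {1..m} \<subseteq> {1..m'}" "\<kappa> ` {1..n} \<subseteq> {1..n'}"
  shows "reducible m' n' (map (map (map_prod \<rho> \<kappa>)) P)"
proof -
  obtain k f where k: "k < length P" "\<forall>t<k. bilinear_form m n (f t)"
    and f: "\<And>x y. edge_squares P x y = (\<Sum>t<k. (f t x y)\<^sup>2)"
    using assms(1) unfolding reducible_def sum_of_bilinear_squares_def by blast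
  have "edge_squares (map (map (map_prod \<rho> \<kappa>)) P) x y = edge_squares P (x \<circ> \<rho>) (y \<circ> \<kappa>)" for x y
    by (simp add: edge_squares_def comp_def monomial_def)
  with k f assms(2,3) show ?thesis
    unfolding reducible_def sum_of_bilinear_squares_def
    by (intro exI[of _ k] conjI exI[of _ "\<lambda>t x y. f t (x \<circ> \<rho>) (y \<circ> \<kappa>)"])
      (simp_all add: bilinear_form_substitute[OF _ assms(2,3)])
qed

lemma bilinear_form_transpose:
  assumes "bilinear_form m n f"
  shows "bilinear_form n m (\<lambda>x y. f y x)"
proof -
  obtain a where a: "\<And>x y. f x y = (\<Sum>c\<in>cells m n. a c * monomial c x y)"
    using assms unfolding bilinear_form_def by blast
  obtain cs where cs: "set cs = cells m n" "distinct cs"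
    using finite_cells finite_distinct_list by blast
  have "(\<lambda>x y. f y x) = linear_combination (map (\<lambda>c. (a c, prod.swap c)) cs)"
    using cs
    by (intro ext) (simp add: a linear_combination_def comp_def monomial_def
        sum_list_distinct_conv_sum_set mult.commute)
  moreover have "bilinear_form n m \<dots>"
    using cs by (intro bilinear_form_linear_combination) (force simp: cells_def)
  ultimately show ?thesis
    by simp
qed

lemma reducible_transpose:
  assumes "reducible m n P"
  shows "reducible n m (map (map prod.swap) P)"
proof -
  obtain k f where k: "k < length P" "\<forall>t<k. bilinear_form m n (f t)"
    and f: "\<And>x y. edge_squares P x y = (\<Sum>t<k. (f t x y)\<^sup>2)"
    using assms unfolding reducible_def sum_of_bilinear_squares_def by blast
  have "edge_squares (map (map prod.swap) P) x y = edge_squares P y x" for x y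
    by (simp add: edge_squares_def comp_def monomial_def mult.commute)
  with k f show ?thesis
    unfolding reducible_def sum_of_bilinear_squares_def
    by (intro exI[of _ k] conjI exI[of _ "\<lambda>t x y. f t y x"])
      (auto intro: bilinear_form_transpose)
qed

section \<open>Edge lists and configurations\<close>

lemma edge_squares_distinct:
  assumes "distinct (map set P)" "\<forall>p\<in>set P. distinct p"
  shows "edge_squares P x y = (\<Sum>e\<in>set (map set P). (\<Sum>c\<in>e. monomial c x y)\<^sup>2)"
proof -
  have "edge_squares P x y = (\<Sum>p\<leftarrow>P. (\<Sum>c\<in>set p. monomial c x y)\<^sup>2)"
    unfolding edge_squares_def using assms(2)
    by (intro arg_cong[of _ _ sum_list] map_cong) (auto simp: sum_list_distinct_conv_sum_set)
  also have "\<dots> = (\<Sum>e\<leftarrow>map set P. (\<Sum>c\<in>e. monomial c x y)\<^sup>2)"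
    by (simp add: comp_def)
  also have "\<dots> = (\<Sum>e\<in>set (map set P). (\<Sum>c\<in>e. monomial c x y)\<^sup>2)"
    using assms(1) by (rule sum_list_distinct_conv_sum_set)
  finally show ?thesis .
qed

lemma finite_one_edges: "augmented_configuration m n G \<Longrightarrow> finite (one_edges G)"
  unfolding augmented_configuration_def by (meson finite_cells finite_subset)

lemma finite_two_edges:
  assumes "augmented_configuration m n G"
  shows "finite (two_edges G)"
proof (rule finite_subset)
  show "two_edges G \<subseteq> Pow (cells m n)"
    using assms unfolding augmented_configuration_def by auto
qed simp

lemma one_edges_disjoint_two_edges:
  assumes "augmented_configuration m n G"
  shows "(\<lambda>c. {c}) ` one_edges G \<inter> two_edges G = {}"
  using assms unfolding augmented_configuration_def by fastforce

lemma card_selected_edges: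
  assumes "augmented_configuration m n G"
  shows "card (selected_edges G) = num_squares G"
proof -
  have "card ((\<lambda>c. {c}) ` one_edges G) = card (one_edges G)"
    by (intro card_image) (simp add: inj_on_def)
  then show ?thesis
    using assms one_edges_disjoint_two_edges[OF assms]
    by (simp add: selected_edges_def num_squares_def card_Un_disjoint finite_one_edges finite_two_edges)
qed

lemma finite_selected_edges: "augmented_configuration m n G \<Longrightarrow> finite (selected_edges G)"
  by (simp add: selected_edges_def finite_one_edges finite_two_edges)

lemma selected_edge_cells:
  assumes "augmented_configuration m n G" "e \<in> selected_edges G"
  shows "finite e" "e \<subseteq> cells m n" "e \<noteq> {}"
proof -
  show "e \<subseteq> cells m n" "e \<noteq> {}"
    using assms unfolding augmented_configuration_def selected_edges_def by fastforce+
  then show "finite e"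
    using finite_subset finite_cells by blast
qed

lemma config_form_eq:
  assumes "augmented_configuration m n G"
  shows "config_form G x y = (\<Sum>e\<in>selected_edges G. (\<Sum>c\<in>e. monomial c x y)\<^sup>2)"
proof -
  have "(\<Sum>e\<in>(\<lambda>c. {c}) ` one_edges G. (\<Sum>c\<in>e. monomial c x y)\<^sup>2)
      = (\<Sum>c\<in>one_edges G. (monomial c x y)\<^sup>2)"
    by (subst sum.reindex) (auto simp: inj_on_def)
  then show ?thesis
    using assms one_edges_disjoint_two_edges[OF assms]
    unfolding config_form_def selected_edges_def
    by (subst sum.union_disjoint) (auto simp: finite_one_edges finite_two_edges)
qed

lemma sum_of_bilinear_squares_config:
  assumes "augmented_configuration m n G"
  shows "sum_of_bilinear_squares m n (num_squares G) (config_form G)"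
proof -
  have "config_form G = (\<lambda>x y. \<Sum>e\<in>selected_edges G. (\<Sum>c\<in>e. monomial c x y)\<^sup>2)"
    using config_form_eq[OF assms] by (intro ext)
  then show ?thesis
    using sum_of_bilinear_squares_sum[of "selected_edges G" m n] assms
    by (simp add: card_selected_edges finite_selected_edges selected_edge_cells)
qed

text \<open>The squares of the edges in \<open>P\<close> are replaced by \<open>k < length P\<close>
  others while the remaining selected edges keep their own, so fewer than
  \<open>num_squares G\<close> squares suffice.\<close>

lemma reducible_imp_not_irreducible:
  assumes G: "augmented_configuration m n G" and "reducible m n P"
    and P: "distinct (map set P)" "\<forall>p\<in>set P. distinct p \<and> set p \<in> selected_edges G"
  shows "\<not> irreducible_configuration m n G"
proof -
  let ?F = "set (map set P)" and ?S = "selected_edges G"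
  obtain k where k: "k < length P" "sum_of_bilinear_squares m n k (edge_squares P)"
    using assms(2) unfolding reducible_def by blast
  have F: "?F \<subseteq> ?S" "card ?F = length P"
    using P distinct_card[OF P(1)] by auto
  have fin: "finite ?S"
    using G by (rule finite_selected_edges)
  have "sum_of_bilinear_squares m n (k + card (?S - ?F))
      (\<lambda>x y. edge_squares P x y + (\<Sum>e\<in>?S - ?F. (\<Sum>c\<in>e. monomial c x y)\<^sup>2))"
    using G fin k(2)
    by (intro sum_of_bilinear_squares_add sum_of_bilinear_squares_sum)
      (auto dest: selected_edge_cells)
  also have "(\<lambda>x y. edge_squares P x y + (\<Sum>e\<in>?S - ?F. (\<Sum>c\<in>e. monomial c x y)\<^sup>2)) = config_form G"
    using P fin F(1)
    by (intro ext) (simp add: config_form_eq[OF G] edge_squares_distinct sum.subset_diff[OF F(1) fin])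
  finally have "SOS m n (config_form G) \<le> k + card (?S - ?F)"
    unfolding SOS_def by (rule Least_le)
  also have "\<dots> < card ?S"
    using k(1) F fin card_mono[OF fin F(1)] by (simp add: card_Diff_subset)
  finally show ?thesis
    using card_selected_edges[OF G] unfolding irreducible_configuration_def by simp
qed

section \<open>Soundness of the recursive rules\<close>

definition unit_vector :: "nat \<Rightarrow> nat \<Rightarrow> real" where
  "unit_vector i = (\<lambda>j. of_bool (j = i))"

text \<open>Evaluation at unit vectors reads off the coefficient of a cell without choosing a
  representation; for a bilinear form it is 0 at cells outside the grid.\<close>

definition coefficient :: "form \<Rightarrow> cell \<Rightarrow> real" where
  "coefficient f c = f (unit_vector (fst c)) (unit_vector (snd c))"

text \<open>With signs \<open>s\<close>, \<open>t\<close>, the value of \<open>f\<close> at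
  \<open>x + s x'\<close>, \<open>y + t y'\<close> is
  \<open>f x y + t f x y' + s f x' y + s t f x' y'\<close>. Summing \<open>s t\<close> times its
  square over the four signs keeps four times the \<open>s t\<close>-coefficient of the square. The
  left side involves only squares of \<open>f\<close>, so it can be added up over a
  representation.\<close>

lemma bilinear_form_polarization:
  assumes "bilinear_form m n f"
  shows "(f (\<lambda>i. x i + x' i) (\<lambda>j. y j + y' j))\<^sup>2 - (f (\<lambda>i. x i - x' i) (\<lambda>j. y j + y' j))\<^sup>2
      - (f (\<lambda>i. x i + x' i) (\<lambda>j. y j - y' j))\<^sup>2 + (f (\<lambda>i. x i - x' i) (\<lambda>j. y j - y' j))\<^sup>2
      = 8 * (f x y * f x' y' + f x y' * f x' y)"
proof -
  obtain a where a: "\<And>x y. f x y = (\<Sum>c\<in>cells m n. a c * monomial c x y)"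
    using assms unfolding bilinear_form_def by blast
  have additive: "f (\<lambda>i. x i + x' i) y = f x y + f x' y" "f (\<lambda>i. x i - x' i) y = f x y - f x' y"
    "f x (\<lambda>j. y j + y' j) = f x y + f x y'" "f x (\<lambda>j. y j - y' j) = f x y - f x y'" for x x' y y'
    by (simp_all add: a monomial_def algebra_simps sum.distrib sum_subtractf)
  show ?thesis
    unfolding additive by (simp add: power2_eq_square algebra_simps)
qed

definition gram :: "'t set \<Rightarrow> ('t \<Rightarrow> form) \<Rightarrow> cell \<Rightarrow> cell \<Rightarrow> real" where
  "gram T f p q = (\<Sum>t\<in>T. coefficient (f t) p * coefficient (f t) q)"

text \<open>Polarization at unit vectors compares the coefficients of
  \<open>x_i x_k y_j y_l\<close>. The families \<open>T\<close> and \<open>S\<close> are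
  independent, so that an arbitrary representation can be compared with the displayed one. For
  \<open>i = k\<close> or \<open>j = l\<close> the two terms on each side coincide, and a single
  inner product is determined.\<close>

lemma gram_rectangle:
  assumes "\<forall>t\<in>T. bilinear_form m n (f t)" "\<forall>e\<in>S. bilinear_form m n (g e)"
    and eq: "\<And>x y. (\<Sum>t\<in>T. (f t x y)\<^sup>2) = (\<Sum>e\<in>S. (g e x y)\<^sup>2)"
  shows "gram T f (i, j) (k, l) + gram T f (i, l) (k, j) = gram S g (i, j) (k, l) + gram S g (i, l) (k, j)"
proof -
  let ?x = "unit_vector i" and ?x' = "unit_vector k" and ?y = "unit_vector j" and ?y' = "unit_vector l"
  \<comment> \<open>\<open>D\<close> is linear in the form, so it can be evaluated square by
    square.\<close>
  define D :: "form \<Rightarrow> real" where "D h =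
      h (\<lambda>i. ?x i + ?x' i) (\<lambda>j. ?y j + ?y' j) - h (\<lambda>i. ?x i - ?x' i) (\<lambda>j. ?y j + ?y' j)
      - h (\<lambda>i. ?x i + ?x' i) (\<lambda>j. ?y j - ?y' j) + h (\<lambda>i. ?x i - ?x' i) (\<lambda>j. ?y j - ?y' j)" for h
  have D: "D (\<lambda>x y. \<Sum>t\<in>U. (h t x y)\<^sup>2) = 8 * (gram U h (i, j) (k, l) + gram U h (i, l) (k, j))"
    if "\<forall>t\<in>U. bilinear_form m n (h t)" for U :: "'u set" and h
  proof -
    have "D (\<lambda>x y. \<Sum>t\<in>U. (h t x y)\<^sup>2) = (\<Sum>t\<in>U. D (\<lambda>x y. (h t x y)\<^sup>2))"
      unfolding D_def by (simp add: sum.distrib sum_subtractf)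
    also have "\<dots> = (\<Sum>t\<in>U. 8 * (coefficient (h t) (i, j) * coefficient (h t) (k, l)
        + coefficient (h t) (i, l) * coefficient (h t) (k, j)))"
      using that unfolding D_def coefficient_def
      by (intro sum.cong refl)
        (use bilinear_form_polarization[where m = m and n = n] in \<open>simp del: distrib_left_numeral\<close>)
    finally show ?thesis
      by (simp add: gram_def sum_distrib_left sum.distrib distrib_left)
  qed
  show ?thesis
    using D[OF assms(1)] D[OF assms(2)] eq by simp
qed

text \<open>In the displayed representation a cell has the unit vector of its edge, or zero if it is
  unoccupied; simplicity leaves at most one edge per cell.\<close>

lemma gram_config:
  assumes G: "augmented_configuration m n G" "simple_configuration G"
  shows "gram (selected_edges G) (\<lambda>e x y. \<Sum>c\<in>e. monomial c x y) p q
      = of_bool (\<exists>e\<in>selected_edges G. p \<in> e \<and> q \<in> e)"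
proof -
  let ?S = "selected_edges G"
  have coefficient: "coefficient (\<lambda>x y. \<Sum>c\<in>e. monomial c x y) p = of_bool (p \<in> e)" if "e \<in> ?S" for e p
  proof -
    have "coefficient (\<lambda>x y. \<Sum>c\<in>e. monomial c x y) p = (\<Sum>c\<in>e. if c = p then 1 else 0)"
      unfolding coefficient_def monomial_def unit_vector_def
      by (intro sum.cong) (auto simp: prod_eq_iff)
    then show ?thesis
      using selected_edge_cells(1)[OF G(1) that] by simp
  qed
  have gram: "gram ?S (\<lambda>e x y. \<Sum>c\<in>e. monomial c x y) p q = (\<Sum>e\<in>?S. of_bool (p \<in> e \<and> q \<in> e))"
    unfolding gram_def by (intro sum.cong) (simp_all add: coefficient of_bool_conj)
  show ?thesis
  proof (cases "\<exists>e\<in>?S. p \<in> e \<and> q \<in> e")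
    case True
    then obtain e where e: "e \<in> ?S" "p \<in> e" "q \<in> e"
      by blast
    have "(\<Sum>e'\<in>?S. of_bool (p \<in> e' \<and> q \<in> e')) = (\<Sum>e'\<in>?S. if e' = e then 1 else 0 :: real)"
      using e G(2) unfolding simple_configuration_def by (intro sum.cong) auto
    then show ?thesis
      using e True finite_selected_edges[OF G(1)] unfolding gram by simp
  next
    case False
    then have "(\<Sum>e\<in>?S. of_bool (p \<in> e \<and> q \<in> e)) = (\<Sum>e\<in>?S. 0 :: real)"
      by (intro sum.cong) auto
    with False show ?thesis
      unfolding gram by simp
  qed
qed

text \<open>Bessel's inequality for each of the \<open>k\<close> coordinate vectors, summed up.\<close>

lemma card_orthonormal_le:
  fixes v :: "'e \<Rightarrow> nat \<Rightarrow> real"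
  assumes "finite S"
    and "\<And>e f. e \<in> S \<Longrightarrow> f \<in> S \<Longrightarrow> (\<Sum>t<k. v e t * v f t) = of_bool (e = f)"
  shows "card S \<le> k"
proof -
  have "(\<Sum>e\<in>S. (v e s)\<^sup>2) \<le> 1" if "s < k" for s
  proof -
    define b where "b = (\<Sum>e\<in>S. (v e s)\<^sup>2)"
    have "(\<Sum>t<k. (\<Sum>e\<in>S. v e s * v e t)\<^sup>2)
        = (\<Sum>t<k. \<Sum>e\<in>S. \<Sum>f\<in>S. v e s * v f s * (v e t * v f t))"
      by (simp add: power2_eq_square sum_product mult.assoc mult.left_commute)
    also have "\<dots> = (\<Sum>e\<in>S. \<Sum>f\<in>S. v e s * v f s * (\<Sum>t<k. v e t * v f t))"
      by (simp add: sum_distrib_left sum.swap[of _ S "{..<k}"])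
    also have "\<dots> = (\<Sum>e\<in>S. \<Sum>f\<in>S. if f = e then (v e s)\<^sup>2 else 0)"
      using assms(2) by (intro sum.cong) (auto simp: power2_eq_square)
    also have "\<dots> = b"
      using assms(1) by (simp add: b_def)
    finally have square: "(\<Sum>t<k. (\<Sum>e\<in>S. v e s * v e t)\<^sup>2) = b" .
    have "0 \<le> (\<Sum>t<k. (of_bool (t = s) - (\<Sum>e\<in>S. v e s * v e t))\<^sup>2)"
      by (intro sum_nonneg) simp
    also have "\<dots> = (\<Sum>t<k. if t = s then 1 - 2 * (\<Sum>e\<in>S. v e s * v e t) else 0)
        + (\<Sum>t<k. (\<Sum>e\<in>S. v e s * v e t)\<^sup>2)"
      unfolding sum.distrib[symmetric]
      by (intro sum.cong refl) (simp add: power2_eq_square algebra_simps)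
    also have "\<dots> = 1 - b"
      using that square by (simp add: b_def power2_eq_square)
    finally show ?thesis
      unfolding b_def by simp
  qed
  then have "(\<Sum>s<k. \<Sum>e\<in>S. (v e s)\<^sup>2) \<le> (\<Sum>s<k. 1)"
    by (intro sum_mono) auto
  moreover have "(\<Sum>s<k. \<Sum>e\<in>S. (v e s)\<^sup>2) = (\<Sum>e\<in>S. \<Sum>s<k. v e s * v e s)"
    by (simp add: sum.swap[of _ S] power2_eq_square)
  moreover have "\<dots> = real (card S)"
    using assms(2) by simp
  ultimately show ?thesis
    by simp
qed

lemma paired_occupied: "paired G p q \<Longrightarrow> p \<in> occupied G \<and> q \<in> occupied G"
  unfolding paired_def occupied_def selected_edges_def by blast

lemma same_edge_iff_paired:
  assumes "augmented_configuration m n G" "p \<noteq> q"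
  shows "(\<exists>e\<in>selected_edges G. p \<in> e \<and> q \<in> e) \<longleftrightarrow> paired G p q"
proof
  assume "\<exists>e\<in>selected_edges G. p \<in> e \<and> q \<in> e"
  then obtain e where e: "e \<in> two_edges G" "{p, q} \<subseteq> e"
    using assms(2) unfolding selected_edges_def by auto
  moreover have "card e = 2"
    using assms(1) e(1) unfolding augmented_configuration_def by blast
  ultimately have "{p, q} = e"
    using assms(2) by (intro card_subset_eq) (auto simp: card_2_iff)
  then show "paired G p q"
    using e unfolding paired_def by simp
qed (auto simp: paired_def selected_edges_def)

text \<open>\<open>B\<close> is the Gram matrix of an arbitrary representation and \<open>W\<close>
  that of the displayed one. Induction over the rules shows that \<open>rw_sim\<close> forces equal
  vectors and \<open>rw_perp\<close> orthogonal ones. Admissibility then gives one unit vector per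
  selected edge, pairwise orthogonal, in dimension \<open>k\<close>.\<close>

lemma admissible_lower_bound:
  assumes G: "augmented_configuration m n G" "simple_configuration G" "RW3_plus_admissible G"
    and sos: "sum_of_bilinear_squares m n k (config_form G)"
  shows "num_squares G \<le> k"
proof -
  let ?S = "selected_edges G"
  obtain f where f: "\<forall>t\<in>{..<k}. bilinear_form m n (f t)"
    and config: "\<And>x y. config_form G x y = (\<Sum>t<k. (f t x y)\<^sup>2)"
    using sos unfolding sum_of_bilinear_squares_def by blast
  define B where "B = gram {..<k} f"
  define v where "v p t = coefficient (f t) p" for p t
  have B: "B p q = (\<Sum>t<k. v p t * v q t)" for p q
    by (simp add: B_def gram_def v_def)
  define W :: "cell \<Rightarrow> cell \<Rightarrow> real" where "W p q = of_bool (\<exists>e\<in>?S. p \<in> e \<and> q \<in> e)" for p q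
  have W_paired: "W p q = of_bool (paired G p q)" if "p \<noteq> q" for p q
    using same_edge_iff_paired[OF G(1) that] by (simp add: W_def)
  have W_refl: "W p p = of_bool (p \<in> occupied G)" for p
    by (simp add: W_def occupied_def Bex_def conj_commute)
  have rect: "B (i, j) (k, l) + B (i, l) (k, j) = W (i, j) (k, l) + W (i, l) (k, j)" for i j k l
    unfolding B_def W_def gram_config[OF G(1,2), symmetric]
    using f G(1) config config_form_eq[OF G(1)]
    by (intro gram_rectangle[where m = m and n = n])
      (auto intro!: bilinear_form_sum dest: selected_edge_cells)
  have B_commute: "B p q = B q p" for p q
    by (simp add: B mult.commute)
  \<comment> \<open>The rectangle spanned by \<open>p\<close> and \<open>q\<close> is degenerate, so
    both of its diagonals are this pair.\<close>
  have line: "B p q = W p q" if "fst p = fst q \<or> snd p = snd q" for p q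
    using that rect[of "fst p" "snd p" "fst q" "snd q"] B_commute[of p q]
    by (cases p; cases q) (auto simp: W_def conj_commute)
  have B_refl: "B p p = of_bool (p \<in> occupied G)" for p
    using line[of p p] W_refl by simp
  have distance: "(\<Sum>t<k. (v p t - v q t)\<^sup>2) = B p p + B q q - 2 * B p q" for p q
    by (simp add: B power2_eq_square algebra_simps sum.distrib sum_subtractf sum_distrib_left)
  have equal: "\<forall>t<k. v p t = v q t" if "p \<in> occupied G" "q \<in> occupied G" "B p q = 1" for p q
  proof -
    have "(\<Sum>t<k. (v p t - v q t)\<^sup>2) = 0"
      using that B_refl distance by simp
    then show ?thesis
      by (subst (asm) sum_nonneg_eq_0_iff) auto
  qed
  have zero: "B p q = 0" if "p \<notin> occupied G" for p q
  proof -
    have "(\<Sum>t<k. (v p t)\<^sup>2) = 0"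
      using B_refl[of p] that by (simp add: B power2_eq_square)
    then have "\<forall>t<k. v p t = 0"
      by (subst (asm) sum_nonneg_eq_0_iff) auto
    then show ?thesis
      by (simp add: B)
  qed
  have B_le: "B p q \<le> 1" for p q
  proof -
    have "0 \<le> (\<Sum>t<k. (v p t - v q t)\<^sup>2)"
      by (intro sum_nonneg) simp
    then show ?thesis
      using B_refl[of p] B_refl[of q] unfolding distance by (simp add: of_bool_def split: if_splits)
  qed
  \<comment> \<open>A certificate makes \<open>B\<close> and \<open>W\<close> agree on one diagonal;
    their sums over both diagonals agree, hence so do the entries on the other one.\<close>
  have certified: "B (i, j) (k', l) = W (i, j) (k', l)"
    if "i \<noteq> k'" "j \<noteq> l" "(\<not> paired G (i, l) (k', j) \<and>
        ((i, l) \<notin> occupied G \<or> (k', j) \<notin> occupied G \<or> B (i, l) (k', j) = 0)) \<or>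
     (paired G (i, l) (k', j) \<and> (\<forall>t<k. v (i, l) t = v (k', j) t))" for i j k' l
  proof -
    have "B (i, l) (k', j) = W (i, l) (k', j)"
    proof (cases "paired G (i, l) (k', j)")
      case True
      then have "B (i, l) (k', j) = B (i, l) (i, l)"
        using that(3) by (simp add: B)
      then show ?thesis
        using True paired_occupied[OF True] that(1) by (simp add: B_refl W_paired)
    next
      case False
      then show ?thesis
        using that zero[of "(i, l)"] zero[of "(k', j)" "(i, l)"] B_commute[of "(i, l)"]
        by (auto simp: W_paired)
    qed
    then show ?thesis
      using rect[of i j k' l] by simp
  qed
  have sound: "(rw_sim G p q \<longrightarrow> (\<forall>t<k. v p t = v q t)) \<and> (rw_perp G p q \<longrightarrow> B p q = 0)" for p q
  proof -
    have "(rw_sim G p q \<longrightarrow> (\<forall>t<k. v p t = v q t)) \<and> (rw_perp G p' q' \<longrightarrow> B p' q' = 0)" for p q p' q'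
    proof (induction rule: rw_sim_rw_perp.induct)
      case (line_sim p q)
      then show ?case
        by (intro equal) (auto simp: line W_paired)
    next
      case (line_perp p q)
      then show ?case
        by (auto simp: line W_paired)
    next
      case (saturation p p' q q')
      then show ?case
        by (simp add: B)
    next
      case (transfer_perp i k' j l)
      then have "B (i, j) (k', l) = W (i, j) (k', l)"
        by (intro certified) auto
      with transfer_perp show ?case
        by (simp add: W_paired)
    next
      case (transfer_sim i k' j l)
      then have "B (i, j) (k', l) = W (i, j) (k', l)"
        by (intro certified) auto
      with transfer_sim show ?case
        by (intro equal) (auto simp: W_paired dest: paired_occupied)
    next
      case (complementary_pair i k' j l)
      then have "B (i, j) (k', l) + B (i, l) (k', j) = 2"
        using rect[of i j k' l] by (simp add: W_paired)
      \<comment> \<open>Two entries that are at most 1 and add up to 2 are both 1.\<close>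
      then have "B (i, j) (k', l) = 1"
        using B_le[of "(i, j)" "(k', l)"] B_le[of "(i, l)" "(k', j)"] by linarith
      with complementary_pair show ?case
        by (intro equal) (auto dest: paired_occupied)
    qed (auto simp: B_commute)
    then show ?thesis
      by blast
  qed
  define c where "c e = (SOME p. p \<in> e)" for e :: "cell set"
  have c: "c e \<in> e" if "e \<in> ?S" for e
    using selected_edge_cells(3)[OF G(1) that] unfolding c_def by (simp add: some_in_eq)
  have same: "\<forall>t<k. v p t = v (c e) t" if "e \<in> ?S" "p \<in> e" for e p
  proof (cases "e \<in> two_edges G")
    case True
    then have "rw_sim G p (c e)"
      using G(3) c[OF that(1)] that(2) unfolding RW3_plus_admissible_def by blast
    then show ?thesis
      using sound by blast
  next
    case False
    then show ?thesis
      using that c[OF that(1)] unfolding selected_edges_def by auto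
  qed
  have "card ?S \<le> k"
  proof (rule card_orthonormal_le[where v = "\<lambda>e. v (c e)"])
    fix e e' assume e: "e \<in> ?S" "e' \<in> ?S"
    show "(\<Sum>t<k. v (c e) t * v (c e') t) = of_bool (e = e')"
    proof (cases "e = e'")
      case True
      have "c e \<in> occupied G"
        using c e(1) unfolding occupied_def by blast
      then have "B (c e) (c e) = 1"
        by (simp only: B_refl of_bool_eq)
      then show ?thesis
        by (simp only: B True[symmetric] of_bool_eq simp_thms)
    next
      case False
      then obtain p q where pq: "p \<in> e" "q \<in> e'" "rw_perp G p q"
        using G(3)[unfolded RW3_plus_admissible_def, THEN conjunct2, rule_format, OF e] by blast
      then have "B p q = 0"
        using sound by blast
      moreover have "B p q = (\<Sum>t<k. v (c e) t * v (c e') t)"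
        using same[OF e(1) pq(1)] same[OF e(2) pq(2)] by (simp add: B)
      ultimately show ?thesis
        using False by simp
    qed
  qed (use G(1) in \<open>rule finite_selected_edges\<close>)
  then show ?thesis
    using card_selected_edges[OF G(1)] by simp
qed

theorem admissible_imp_irreducible:
  assumes "augmented_configuration m n G" "simple_configuration G" "RW3_plus_admissible G"
  shows "irreducible_configuration m n G"
  unfolding irreducible_configuration_def SOS_def
  using sum_of_bilinear_squares_config[OF assms(1)] admissible_lower_bound[OF assms]
  by (rule Least_equality)

section \<open>Reducible patterns\<close>

text \<open>
  Rewritings of a few of the squares. Where no irrational coefficient occurs, the cells are regrouped
  into signed sums, for instance \<open>(s + s')\<^sup>2 + r\<^sup>2 + (r' + w)\<^sup>2 + a\<^sup>2 + b\<^sup>2 = s\<^sup>2 + s'\<^sup>2 + (r + r' + w)\<^sup>2 + (a - b)\<^sup>2\<close>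
  when \<open>s s' = r r'\<close> and \<open>r w = a b\<close>. In the patterns with \<open>2 s\<^sup>2 = 1\<close>, products of the given forms are
  linearly dependent, say \<open>y (x + x') + \<Sum> a\<^sub>i b\<^sub>i = 0\<close>, and adding the right multiple of this relation
  makes the Gram matrix of the forms singular.
\<close>

definition pattern1 :: "cell list list" where
  "pattern1 = [
    [(1, 1)], [(2, 1)], [(2, 2)], [(2, 3)], [(1, 2), (1, 3)]]"

lemma reducible_pattern1: "reducible 2 3 pattern1"
proof -
  obtain s :: real where s: "2 * (s * s) = 1"
    by (rule that[of "sqrt (1 / 2)"]) simp
  \<comment> \<open>The relation is \<open>u_11 (u_22 + u_23) = u_21 (u_12 + u_13)\<close>. Adding
    \<open>s\<close> times one factor inside the square of the other creates cross terms that cancel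
    by it; as \<open>s^2 = 1/2\<close>, half of \<open>u_21^2\<close> and of
    \<open>u_22^2 + u_23^2\<close> is thereby used and the remaining squares supply the other
    half.\<close>
  show ?thesis
  proof (rule reducibleI[of "[
      [(1, (1, 1)), (s, (2, 2)), (s, (2, 3))], [(s, (2, 2)), (- s, (2, 3))],
      [(1, (1, 2)), (1, (1, 3)), (- s, (2, 1))], [(s, (2, 1))]]"], goal_cases)
    case (3 x y)
    show ?case
      using s unfolding pattern1_def edge_squares_def linear_combination_def monomial_def by simp algebra
  qed (simp_all add: pattern1_def cells_def)
qed

definition pattern2 :: "cell list list" where
  "pattern2 = [
    [(1, 1)], [(2, 1)], [(3, 1)], [(3, 2)], [(3, 3)], [(1, 2), (2, 3)]]"

lemma reducible_pattern2: "reducible 3 3 pattern2"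
proof (rule reducibleI[of "[
      [(1, (1, 1)), (-1, (3, 2))], [(1, (1, 2)), (1, (2, 3)), (1, (3, 1))],
      [(1, (2, 1)), (-1, (3, 3))]]"], goal_cases)
  case (3 x y)
  show ?case
    unfolding pattern2_def edge_squares_def linear_combination_def monomial_def by simp algebra
qed (simp_all add: pattern2_def cells_def)

definition pattern3 :: "cell list list" where
  "pattern3 = [
    [(1, 1)], [(2, 2)], [(2, 3)], [(3, 1)], [(3, 3)], [(1, 2), (2, 1)]]"

lemma reducible_pattern3: "reducible 3 3 pattern3"
proof (rule reducibleI[of "[
      [(1, (1, 1)), (1, (2, 2))], [(1, (1, 2))], [(1, (2, 1)), (-1, (3, 3))],
      [(1, (2, 3)), (1, (3, 1))]]"], goal_cases)
  case (3 x y)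
  show ?case
    unfolding pattern3_def edge_squares_def linear_combination_def monomial_def by simp algebra
qed (simp_all add: pattern3_def cells_def)

definition pattern4 :: "cell list list" where
  "pattern4 = [
    [(1, 1)], [(2, 2)], [(3, 1)], [(3, 2)], [(1, 2), (2, 1)]]"

lemma reducible_pattern4: "reducible 3 2 pattern4"
proof -
  \<comment> \<open>The cross term \<open>2 u_12 u_21\<close> is spread evenly over both diagonals
    of the rectangle in rows 1 and 2, whence \<open>h = 1/2\<close>. The remaining weight
    \<open>s^2 = 3/4\<close> of \<open>u_11^2\<close> and \<open>u_12^2\<close> is carried by the
    squares of row 3, whose two cross terms cancel.\<close>
  obtain s h :: real where s: "s * s + h * h = 1" "2 * h = 1"
    by (rule that[of "sqrt 3 / 2" "1 / 2"]) simp_all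
  show ?thesis
  proof (rule reducibleI[of "[
      [(1, (3, 1)), (s, (1, 2))], [(1, (3, 2)), (- s, (1, 1))], [(1, (2, 1)), (h, (1, 2))],
      [(1, (2, 2)), (h, (1, 1))]]"], goal_cases)
    case (3 x y)
    show ?case
      using s unfolding pattern4_def edge_squares_def linear_combination_def monomial_def by simp algebra
  qed (simp_all add: pattern4_def cells_def)
qed

definition pattern5 :: "cell list list" where
  "pattern5 = [
    [(1, 1)], [(1, 2)], [(2, 1)], [(3, 1)], [(3, 4)], [(1, 3), (1, 4)], [(2, 2), (3, 3)]]"

text \<open>The relation used is
  \<open>u_31 (u_13 + u_14) + u_21 u_12 = u_11 (u_22 + u_33 + u_34)\<close>.\<close>

lemma reducible_pattern5: "reducible 3 4 pattern5"
proof -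
  obtain s :: real where s: "2 * (s * s) = 1"
    by (rule that[of "sqrt (1 / 2)"]) simp
  show ?thesis
  proof (rule reducibleI[of "[
      [(1, (1, 1)), (- s, (3, 4)), (- s, (2, 2)), (- s, (3, 3))],
      [(- s, (3, 4)), (s, (2, 2)), (s, (3, 3))], [(1, (2, 1)), (s, (1, 2))], [(s, (1, 2))],
      [(1, (1, 3)), (1, (1, 4)), (s, (3, 1))], [(s, (3, 1))]]"], goal_cases)
    case (3 x y)
    show ?case
      using s unfolding pattern5_def edge_squares_def linear_combination_def monomial_def by simp algebra
  qed (simp_all add: pattern5_def cells_def)
qed

definition pattern6 :: "cell list list" where
  "pattern6 = [
    [(2, 2)], [(3, 1)], [(3, 3)], [(4, 1)], [(4, 2)], [(1, 2), (2, 3)], [(1, 3), (3, 2)]]"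

lemma reducible_pattern6: "reducible 4 3 pattern6"
proof (rule reducibleI[of "[
      [(1, (1, 2)), (1, (3, 3))], [(1, (1, 3)), (1, (2, 2))], [(1, (2, 3))],
      [(1, (3, 1)), (-1, (4, 2))], [(1, (3, 2)), (1, (4, 1))]]"], goal_cases)
  case (3 x y)
  show ?case
    unfolding pattern6_def edge_squares_def linear_combination_def monomial_def by simp algebra
qed (simp_all add: pattern6_def cells_def)

definition pattern7 :: "cell list list" where
  "pattern7 = [
    [(2, 1)], [(2, 2)], [(3, 2)], [(1, 2), (2, 3)], [(1, 3), (3, 1)]]"

lemma reducible_pattern7: "reducible 3 3 pattern7"
proof (rule reducibleI[of "[
      [(1, (1, 2))], [(1, (1, 3)), (1, (2, 2)), (1, (3, 1))], [(1, (2, 1)), (-1, (3, 2))],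
      [(1, (2, 3))]]"], goal_cases)
  case (3 x y)
  show ?case
    unfolding pattern7_def edge_squares_def linear_combination_def monomial_def by simp algebra
qed (simp_all add: pattern7_def cells_def)

definition pattern8 :: "cell list list" where
  "pattern8 = [
    [(1, 1)], [(1, 2)], [(2, 1)], [(3, 1)], [(3, 4)], [(1, 3), (2, 4)], [(2, 2), (3, 3)]]"

text \<open>The relation used is \<open>u_31 (u_13 + u_24) + u_21 u_12 = u_11 (u_22 + u_33) + u_21
  u_34\<close>.\<close>

lemma reducible_pattern8: "reducible 3 4 pattern8"
proof -
  obtain s :: real where s: "2 * (s * s) = 1"
    by (rule that[of "sqrt (1 / 2)"]) simp
  show ?thesis
  proof (rule reducibleI[of "[
      [(1, (2, 1)), (s, (1, 2)), (- s, (3, 4))], [(s, (1, 2)), (s, (3, 4))],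
      [(1, (1, 3)), (1, (2, 4)), (s, (3, 1))], [(s, (3, 1))],
      [(1, (2, 2)), (1, (3, 3)), (- s, (1, 1))], [(s, (1, 1))]]"], goal_cases)
    case (3 x y)
    show ?case
      using s unfolding pattern8_def edge_squares_def linear_combination_def monomial_def by simp algebra
  qed (simp_all add: pattern8_def cells_def)
qed

definition pattern9 :: "cell list list" where
  "pattern9 = [
    [(1, 1)], [(1, 2)], [(2, 2)], [(2, 4)], [(3, 2)], [(3, 3)], [(3, 5)], [(1, 4), (2, 5)],
    [(1, 5), (2, 1)], [(2, 3), (3, 1)]]"

text \<open>The cross terms of the three two-edges reappear as \<open>u_15 u_24 = u_14 u_25\<close>,
  \<open>u_11 u_25 = u_15 u_21\<close> and \<open>u_21 u_33 = u_23 u_31\<close>; the other products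
  cancel by \<open>u_11 u_32 = u_12 u_31\<close> and \<open>u_25 u_32 = u_22 u_35\<close>.\<close>

lemma reducible_pattern9: "reducible 3 5 pattern9"
proof (rule reducibleI[of "[
      [(1, (1, 1)), (1, (2, 5)), (-1, (3, 2))], [(1, (1, 2)), (1, (3, 1))], [(1, (1, 4))],
      [(1, (1, 5)), (1, (2, 4))], [(1, (2, 1)), (1, (3, 3))], [(1, (2, 2)), (1, (3, 5))],
      [(1, (2, 3))]]"], goal_cases)
  case (3 x y)
  show ?case
    unfolding pattern9_def edge_squares_def linear_combination_def monomial_def by simp algebra
qed (simp_all add: pattern9_def cells_def)

definition pattern10 :: "cell list list" where
  "pattern10 = [
    [(1, 1)], [(3, 3)], [(4, 1)], [(4, 2)], [(4, 3)], [(4, 4)], [(1, 2), (2, 3)],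
    [(2, 1), (3, 4)]]"

lemma reducible_pattern10: "reducible 4 4 pattern10"
proof (rule reducibleI[of "[
      [(1, (1, 1)), (-1, (4, 2))], [(1, (1, 2)), (1, (2, 3)), (1, (4, 1))],
      [(1, (2, 1)), (1, (3, 4)), (-1, (4, 3))], [(1, (3, 3)), (1, (4, 4))]]"], goal_cases)
  case (3 x y)
  show ?case
    unfolding pattern10_def edge_squares_def linear_combination_def monomial_def by simp algebra
qed (simp_all add: pattern10_def cells_def)

definition pattern11 :: "cell list list" where
  "pattern11 = [
    [(1, 1)], [(1, 2)], [(2, 1)], [(3, 1)], [(3, 3)], [(4, 1)], [(1, 3), (2, 2)],
    [(1, 4), (3, 2)], [(2, 4), (4, 2)]]"

text \<open>The relation used is \<open>u_11 (u_33 - u_24 - u_42) + u_41 u_12 + u_21 (u_14 + u_32) =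
  u_31 (u_13 + u_22)\<close>.\<close>

lemma reducible_pattern11: "reducible 4 4 pattern11"
proof -
  obtain s :: real where s: "2 * (s * s) = 1"
    by (rule that[of "sqrt (1 / 2)"]) simp
  show ?thesis
  proof (rule reducibleI[of "[
      [(1, (1, 1)), (s, (3, 3)), (- s, (2, 4)), (- s, (4, 2))],
      [(s, (3, 3)), (s, (2, 4)), (s, (4, 2))], [(1, (4, 1)), (s, (1, 2))], [(s, (1, 2))],
      [(1, (1, 3)), (1, (2, 2)), (- s, (3, 1))], [(s, (3, 1))],
      [(1, (1, 4)), (1, (3, 2)), (s, (2, 1))], [(s, (2, 1))]]"], goal_cases)
    case (3 x y)
    show ?case
      using s unfolding pattern11_def edge_squares_def linear_combination_def monomial_def by simp algebra
  qed (simp_all add: pattern11_def cells_def)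
qed

definition pattern12 :: "cell list list" where
  "pattern12 = [
    [(1, 1)], [(2, 1)], [(3, 1)], [(3, 3)], [(4, 1)], [(4, 4)], [(1, 2), (2, 3)],
    [(1, 3), (2, 4)], [(3, 2), (4, 3)]]"

text \<open>The relation used is \<open>u_21 (u_33 + u_44) + u_11 (u_32 + u_43) = u_31 (u_12 + u_23)
  + u_41 (u_13 + u_24)\<close>.\<close>

lemma reducible_pattern12: "reducible 4 4 pattern12"
proof -
  obtain s :: real where s: "2 * (s * s) = 1"
    by (rule that[of "sqrt (1 / 2)"]) simp
  show ?thesis
  proof (rule reducibleI[of "[
      [(1, (2, 1)), (s, (3, 3)), (s, (4, 4))], [(s, (3, 3)), (- s, (4, 4))],
      [(1, (1, 2)), (1, (2, 3)), (- s, (3, 1))], [(s, (3, 1))],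
      [(1, (1, 3)), (1, (2, 4)), (- s, (4, 1))], [(s, (4, 1))],
      [(1, (3, 2)), (1, (4, 3)), (s, (1, 1))], [(s, (1, 1))]]"], goal_cases)
    case (3 x y)
    show ?case
      using s unfolding pattern12_def edge_squares_def linear_combination_def monomial_def by simp algebra
  qed (simp_all add: pattern12_def cells_def)
qed

definition pattern13 :: "cell list list" where
  "pattern13 = [
    [(1, 1)], [(2, 2)], [(3, 3)], [(4, 4)], [(1, 2), (3, 4)], [(1, 3), (4, 2)],
    [(2, 1), (4, 3)], [(2, 4), (3, 1)]]"

text \<open>Merging two of the two-edges into one square produces
  \<open>u_12 u_43 = u_13 u_42\<close> and \<open>u_21 u_34 = u_24 u_31\<close>, the cross terms of
  the two that are split up; its products \<open>u_12 u_21\<close> and \<open>u_34 u_43\<close> are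
  compensated by the diagonal cells.\<close>

lemma reducible_pattern13: "reducible 4 4 pattern13"
proof (rule reducibleI[of "[
      [(1, (1, 1)), (-1, (2, 2))], [(1, (1, 2)), (1, (2, 1)), (1, (3, 4)), (1, (4, 3))],
      [(1, (3, 3)), (-1, (4, 4))], [(1, (1, 3))], [(1, (4, 2))], [(1, (2, 4))], [(1, (3, 1))]]"], goal_cases)
  case (3 x y)
  show ?case
    unfolding pattern13_def edge_squares_def linear_combination_def monomial_def by simp algebra
qed (simp_all add: pattern13_def cells_def)

section \<open>Extremal sets without rectangles\<close>

text \<open>
  The extremal \<open>C\<^sub>4\<close>-free sets are found by listing the rows (as sorted lists of columns) in order of
  decreasing size, which is possible up to a permutation of the rows.
\<close>

definition meet_once :: "nat list \<Rightarrow> nat list \<Rightarrow> bool" where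
  "meet_once c d \<longleftrightarrow> length (filter (\<lambda>j. j \<in> set d) c) \<le> 1"

text \<open>Backtracking with \<open>n\<close> rows still to choose and \<open>need\<close> cells
  still to place. A chosen row stays available, since short rows may be repeated. The candidates
  come in order of decreasing length, so \<open>Suc n * length c\<close> bounds what can still be
  gained. Truncated subtraction makes \<open>need = 0\<close> mean that enough cells were
  placed.\<close>

fun row_families :: "nat \<Rightarrow> nat list list \<Rightarrow> nat \<Rightarrow> nat list list \<Rightarrow> nat list list list" where
  "row_families 0 cs need chosen = (if need = 0 then [chosen] else [])"
| "row_families (Suc n) [] need chosen = []"
| "row_families (Suc n) (c # cs) need chosen =
     (if need > Suc n * length c then []
      else (if list_all (meet_once c) chosen
            then row_families n (c # cs) (need - length c) (c # chosen) else []) @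
           row_families (Suc n) cs need chosen)"

text \<open>The order of the rows is immaterial but repetitions matter, hence the multiset
  \<open>X\<close>; \<open>{#c, d#} \<subseteq># X\<close> with \<open>c = d\<close> speaks of a row
  that occurs twice.\<close>

lemma row_families_complete:
  assumes "sorted_wrt (\<lambda>c d. length d \<le> length c) cs" "size X = n" "set_mset X \<subseteq> set cs"
    and "\<forall>c d. {#c, d#} \<subseteq># X \<longrightarrow> meet_once c d" "\<forall>c\<in>#X. list_all (meet_once c) chosen"
    and "need \<le> (\<Sum>c\<in>#X. length c)"
  shows "\<exists>f\<in>set (row_families n cs need chosen). mset f = X + mset chosen"
  using assms
proof (induction n cs need chosen arbitrary: X rule: row_families.induct)
  case (1 cs need chosen)
  then show ?case
    by simp
next
  case (2 n need chosen)
  then show ?case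
    by simp
next
  case (3 n c cs need chosen)
  \<comment> \<open>All rows in \<open>X\<close> are candidates from \<open>c\<close> onwards, hence
    no longer than \<open>c\<close>: the pruning test does not fire.\<close>
  have "(\<Sum>d\<in>#X. length d) \<le> (\<Sum>d\<in>#X. length c)"
    using 3(3,5) by (intro sum_mset_mono) auto
  then have need: "\<not> need > Suc n * length c"
    using 3(4,8) by simp
  show ?case
  proof (cases "c \<in># X")
    case True
    then obtain Y where Y: "X = add_mset c Y"
      by (meson multi_member_split)
    have "Y \<subseteq># X"
      by (simp add: Y)
    have chosen: "list_all (meet_once c) chosen"
      using 3(7) True by blast
    have "\<exists>f\<in>set (row_families n (c # cs) (need - length c) (c # chosen)).
        mset f = Y + mset (c # chosen)"
    proof (rule 3(1)[OF need chosen])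
      show "\<forall>a d. {#a, d#} \<subseteq># Y \<longrightarrow> meet_once a d"
        using 3(6) \<open>Y \<subseteq># X\<close> subset_mset.order_trans by blast
      have "meet_once d c" if "d \<in># Y" for d
      proof -
        obtain Z where "Y = add_mset d Z"
          using \<open>d \<in># Y\<close> by (meson multi_member_split)
        then have "{#d, c#} \<subseteq># X"
          by (simp add: Y)
        then show ?thesis
          using 3(6) by blast
      qed
      then show "\<forall>a\<in>#Y. list_all (meet_once a) (c # chosen)"
        using 3(7) Y by simp
    qed (use 3 Y in auto)
    then show ?thesis
      using need chosen Y by auto
  next
    case False
    have "\<exists>f\<in>set (row_families (Suc n) cs need chosen). mset f = X + mset chosen"
      by (rule 3(2)[OF need]) (use 3 False in auto)
    then show ?thesis
      using need by auto
  qed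
qed

definition all_rows :: "nat list list" where
  "all_rows = concat (map (\<lambda>k. filter (\<lambda>r. length r = k) (subseqs [1, 2, 3, 4, 5])) [5, 4, 3, 2, 1, 0])"

text \<open>With columns as points and rows as lines: the two lines \<open>235\<close> and
  \<open>145\<close> through the point 5, and three of the four two-point lines joining them
  elsewhere. Only the pair \<open>3\<close>, \<open>4\<close> lies on no line.\<close>

definition rows_A :: "nat list list" where
  "rows_A = [[1, 2], [1, 3], [2, 4], [2, 3, 5], [1, 4, 5]]"

text \<open>The near-pencil on five points: the line \<open>1234\<close> and its joins with the
  point 5.\<close>

definition rows_B :: "nat list list" where
  "rows_B = [[1, 5], [2, 5], [3, 5], [4, 5], [1, 2, 3, 4]]"

definition relabel_row :: "nat list \<Rightarrow> nat list \<Rightarrow> nat list" where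
  "relabel_row k r = sort (map (\<lambda>j. k ! (j - 1)) r)"

text \<open>One inclusion is enough by counting: as \<open>f\<close> is distinct and the lengths
  agree, \<open>g\<close> is distinct too and has the same elements.\<close>

definition same_rows :: "nat list list \<Rightarrow> nat list list \<Rightarrow> bool" where
  "same_rows f g \<longleftrightarrow> length f = length g \<and> distinct f \<and> list_all (\<lambda>r. r \<in> set g) f"

definition isomorphic_rows :: "nat list list \<Rightarrow> nat list list \<times> nat list \<Rightarrow> bool" where
  "isomorphic_rows f = (\<lambda>(C, k). same_rows f (map (relabel_row k) C))"

text \<open>The entries correspond to those of \<open>row_families 5 all_rows 12 []\<close>; the second component relabels the columns.\<close>

definition extremal_labels :: "(nat list list \<times> nat list) list" where
  "extremal_labels = [
    (rows_B, [1, 2, 3, 4, 5]), (rows_B, [1, 2, 3, 5, 4]), (rows_B, [1, 2, 4, 5, 3]),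
    (rows_B, [1, 3, 4, 5, 2]), (rows_B, [2, 3, 4, 5, 1]), (rows_A, [2, 4, 5, 3, 1]),
    (rows_A, [2, 5, 4, 3, 1]), (rows_A, [3, 4, 5, 2, 1]), (rows_A, [3, 5, 4, 2, 1]),
    (rows_A, [1, 4, 5, 3, 2]), (rows_A, [1, 5, 4, 3, 2]), (rows_A, [3, 4, 5, 1, 2]),
    (rows_A, [3, 5, 4, 1, 2]), (rows_A, [1, 4, 5, 2, 3]), (rows_A, [1, 5, 4, 2, 3]),
    (rows_A, [2, 4, 5, 1, 3]), (rows_A, [2, 5, 4, 1, 3]), (rows_A, [2, 3, 5, 4, 1]),
    (rows_A, [2, 5, 3, 4, 1]), (rows_A, [3, 4, 2, 5, 1]), (rows_A, [4, 5, 3, 2, 1]),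
    (rows_A, [1, 3, 5, 4, 2]), (rows_A, [1, 5, 3, 4, 2]), (rows_A, [3, 4, 1, 5, 2]),
    (rows_A, [4, 5, 3, 1, 2]), (rows_A, [1, 3, 5, 2, 4]), (rows_A, [1, 5, 3, 2, 4]),
    (rows_A, [2, 3, 5, 1, 4]), (rows_A, [2, 5, 3, 1, 4]), (rows_A, [2, 3, 4, 5, 1]),
    (rows_A, [2, 4, 3, 5, 1]), (rows_A, [3, 5, 2, 4, 1]), (rows_A, [4, 5, 2, 3, 1]),
    (rows_A, [1, 3, 4, 5, 2]), (rows_A, [1, 4, 3, 5, 2]), (rows_A, [3, 5, 1, 4, 2]),
    (rows_A, [4, 5, 1, 3, 2]), (rows_A, [1, 3, 4, 2, 5]), (rows_A, [1, 4, 3, 2, 5]),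
    (rows_A, [2, 3, 4, 1, 5]), (rows_A, [2, 4, 3, 1, 5]), (rows_A, [1, 2, 5, 4, 3]),
    (rows_A, [1, 5, 2, 4, 3]), (rows_A, [2, 4, 1, 5, 3]), (rows_A, [4, 5, 2, 1, 3]),
    (rows_A, [1, 2, 5, 3, 4]), (rows_A, [1, 5, 2, 3, 4]), (rows_A, [2, 3, 1, 5, 4]),
    (rows_A, [3, 5, 2, 1, 4]), (rows_A, [1, 2, 4, 5, 3]), (rows_A, [1, 4, 2, 5, 3]),
    (rows_A, [2, 5, 1, 4, 3]), (rows_A, [4, 5, 1, 2, 3]), (rows_A, [1, 2, 4, 3, 5]),
    (rows_A, [1, 4, 2, 3, 5]), (rows_A, [2, 3, 1, 4, 5]), (rows_A, [3, 4, 2, 1, 5]),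
    (rows_A, [1, 2, 3, 5, 4]), (rows_A, [1, 3, 2, 5, 4]), (rows_A, [2, 5, 1, 3, 4]),
    (rows_A, [3, 5, 1, 2, 4]), (rows_A, [1, 2, 3, 4, 5]), (rows_A, [1, 3, 2, 4, 5]),
    (rows_A, [2, 4, 1, 3, 5]), (rows_A, [3, 4, 1, 2, 5])]"

text \<open>There are 65 families: \<open>rows_B\<close> has 24 column symmetries and
  \<open>rows_A\<close> has 2, so they contribute 120/24 = 5 and 120/2 = 60 relabellings.\<close>

lemma row_families_5_5: "list_all2 isomorphic_rows (row_families 5 all_rows 12 []) extremal_labels"
  by code_simp

lemma no_row_families_5_5: "row_families 5 all_rows 13 [] = []"
  by code_simp

lemma extremal_labels:
  "list_all (\<lambda>(C, k). (C = rows_A \<or> C = rows_B) \<and> length k = 5 \<and> distinct k \<and> list_all (\<lambda>j. 1 \<le> j \<and> j \<le> 5) k)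
     extremal_labels"
  by code_simp

definition row :: "cell set \<Rightarrow> nat \<Rightarrow> nat list" where
  "row E i = filter (\<lambda>j. (i, j) \<in> E) [1..<6]"

lemma filter_in_subseqs: "filter P xs \<in> set (subseqs xs)"
  by (induction xs) (auto simp: Let_def)

lemma row_in_all_rows: "row E i \<in> set all_rows"
proof -
  have upt: "[1..<6] = [1, 2, 3, 4, 5 :: nat]"
    by (simp add: upt_rec)
  have "length (row E i) \<le> 5"
    unfolding row_def by (rule order.trans[OF length_filter_le]) simp
  moreover have "n \<in> set [5, 4, 3, 2, 1, 0]" if "n \<le> 5" for n :: nat
    using that by simp linarith
  ultimately have "length (row E i) \<in> set [5, 4, 3, 2, 1, 0]"
    by blast
  moreover have "row E i \<in> set (subseqs [1, 2, 3, 4, 5])"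
    unfolding row_def upt by (rule filter_in_subseqs)
  then have "row E i \<in> set (filter (\<lambda>r. length r = length (row E i)) (subseqs [1, 2, 3, 4, 5]))"
    by (simp only: set_filter mem_Collect_eq simp_thms)
  ultimately show ?thesis
    unfolding all_rows_def set_concat set_map image_image by (rule UN_I)
qed

lemma sorted_all_rows: "sorted_wrt (\<lambda>c d. length d \<le> length c) all_rows"
  by code_simp

lemma distinct_row: "distinct (row E i)"
  by (simp add: row_def)

lemma set_row: "set (row E i) = {j \<in> {1..5}. (i, j) \<in> E}"
  by (auto simp: row_def)

lemma row_families_of_C4_free:
  assumes E: "E \<subseteq> cells 5 5" "C4_free E" "need \<le> card E"
  shows "\<exists>f\<in>set (row_families 5 all_rows need []). mset f = mset (map (row E) [1..<6])"
proof -
  let ?X = "image_mset (row E) (mset_set {1..5})"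
  have X: "?X = mset (map (row E) [1..<6])"
    by (simp add: mset_set_upto_eq_mset_upto atLeastAtMost_upt)
  have meet: "meet_once c d" if cd: "{#c, d#} \<subseteq># ?X" for c d
  proof -
    have "c \<in># ?X"
      using cd by (meson insert_subset_eq_iff)
    then obtain i where i: "i \<in> {1..5}" "c = row E i"
      by auto
    \<comment> \<open>Splitting off the index \<open>i\<close> gives two different row indices even
      when \<open>c = d\<close>.\<close>
    have Xi: "?X = add_mset c (image_mset (row E) (mset_set ({1..5} - {i})))"
      using i by (simp add: mset_set.remove)
    have "d \<in># image_mset (row E) (mset_set ({1..5} - {i}))"
      using cd unfolding Xi by simp
    then have "d \<in> row E ` ({1..5} - {i})"
      by simp
    then obtain i' where i': "i' \<in> {1..5} - {i}" "d = row E i'"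
      by blast
    have "j = l" if "j \<in> set c" "j \<in> set d" "l \<in> set c" "l \<in> set d" for j l
      using that E(2) i' unfolding i(2) i'(2) set_row C4_free_def by blast
    then have "card (set (filter (\<lambda>j. j \<in> set d) c)) \<le> 1"
      by (intro card_le_Suc0_iff_eq[THEN iffD2, simplified One_nat_def[symmetric]]) auto
    then show ?thesis
      unfolding meet_once_def i(2) using distinct_row by (metis distinct_card distinct_filter)
  qed
  have "E = (SIGMA i:{1..5}. set (row E i))"
    using E(1) unfolding set_row cells_def by auto
  then have "card E = (\<Sum>i\<in>{1..5}. card (set (row E i)))"
    by (metis card_SigmaI finite_atLeastAtMost List.finite_set)
  also have "\<dots> = (\<Sum>c\<in>#?X. length c)"
    using distinct_row by (simp add: distinct_card sum_unfold_sum_mset image_mset.compositionality comp_def)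
  finally have "need \<le> (\<Sum>c\<in>#?X. length c)"
    using E(3) by simp
  then have "\<exists>f\<in>set (row_families 5 all_rows need []). mset f = ?X + mset []"
    using sorted_all_rows meet row_in_all_rows
    by (intro row_families_complete) auto
  then show ?thesis
    using X by simp
qed

lemma card_C4_free_5_5:
  assumes "E \<subseteq> cells 5 5" "C4_free E"
  shows "card E \<le> 12"
proof (rule ccontr)
  assume "\<not> ?thesis"
  then have "13 \<le> card E"
    by simp
  from row_families_of_C4_free[OF assms this] show False
    by (simp add: no_row_families_5_5)
qed

definition cells_of_rows :: "nat list list \<Rightarrow> cell set" where
  "cells_of_rows C = {(i, j). 1 \<le> i \<and> i \<le> length C \<and> j \<in> set (C ! (i - 1))}"

text \<open>The label of the family found by the search provides \<kappa>, and \<rho> is the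
  permutation that matches two lists of rows with the same multiset. Both translate between indices
  from 1 and list positions from 0.\<close>

theorem extremal_C4_free_5_5:
  assumes E: "E \<subseteq> cells 5 5" "C4_free E" "card E = 12"
  obtains C \<rho> \<kappa> where "C = rows_A \<or> C = rows_B" "bij_betw \<rho> {1..5} {1..5}" "bij_betw \<kappa> {1..5} {1..5}"
    "E = map_prod \<rho> \<kappa> ` cells_of_rows C"
proof -
  obtain f where f: "f \<in> set (row_families 5 all_rows 12 [])"
    "mset f = mset (map (row E) [1..<6])"
    using row_families_of_C4_free[OF E(1,2), of 12] E(3) by (metis order_refl)
  obtain t where t_in: "t \<in> set extremal_labels" and t_iso: "isomorphic_rows f t"
  proof -
    obtain i where "i < length (row_families 5 all_rows 12 [])" "f = row_families 5 all_rows 12 [] ! i"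
      using f(1) unfolding in_set_conv_nth by blast
    then show ?thesis
      using row_families_5_5 that[of "extremal_labels ! i"]
        list_all2_nthD[OF row_families_5_5] list_all2_lengthD[OF row_families_5_5] by (metis nth_mem)
  qed
  obtain C k where C: "C = rows_A \<or> C = rows_B" and k: "length k = 5" "distinct k" "set k \<subseteq> {1..5}"
    and same: "same_rows f (map (relabel_row k) C)"
  proof -
    obtain C k where t: "t = (C, k)"
      by (cases t)
    have "(C = rows_A \<or> C = rows_B) \<and> length k = 5 \<and> distinct k \<and> list_all (\<lambda>j. 1 \<le> j \<and> j \<le> 5) k"
      using extremal_labels t_in unfolding list_all_iff t by blast
    moreover from this have "set k \<subseteq> {1..5}"
      by (auto simp: list_all_iff)
    ultimately show ?thesis
      using that[of C k] t_iso by (simp add: t isomorphic_rows_def)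
  qed
  have len: "length C = 5"
    using C by (auto simp: rows_A_def rows_B_def)
  define \<kappa> where "\<kappa> j = k ! (j - 1)" for j
  have "bij_betw \<kappa> {1..5} (set k)"
  proof -
    have "bij_betw (\<lambda>j. j - 1) {1..5} {..<5 :: nat}"
      by (rule bij_betw_byWitness[where f' = Suc]) auto
    from bij_betw_trans[OF this bij_betw_nth[OF k(2) refl refl, unfolded k(1)]] show ?thesis
      by (simp add: \<kappa>_def[abs_def] comp_def)
  qed
  moreover have "set k = {1..5}"
    using k by (intro card_subset_eq) (auto simp: distinct_card)
  ultimately have \<kappa>: "bij_betw \<kappa> {1..5} {1..5}"
    by simp
  have "mset f = mset (map (relabel_row k) C)"
  proof -
    let ?g = "map (relabel_row k) C"
    have f: "set f \<subseteq> set ?g" "distinct f" "length f = length ?g"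
      using same unfolding same_rows_def list_all_iff by auto
    then have card: "card (set f) = length ?g"
      by (simp add: distinct_card)
    then have "set f = set ?g"
      using f(1) card_length[of ?g] by (intro card_seteq) auto
    moreover from this have "distinct ?g"
      using card by (intro card_distinct) simp
    ultimately show ?thesis
      using f(2) set_eq_iff_mset_eq_distinct by blast
  qed
  then have "mset (map (relabel_row k) C) = mset (map (row E) [1..<6])"
    using f(2) by simp
  then obtain p where p: "p permutes {..<5}"
    "permute_list p (map (row E) [1..<6]) = map (relabel_row k) C"
    by (rule mset_eq_permutation) simp
  define \<rho> where "\<rho> i = Suc (p (i - 1))" for i
  have p_lt: "p i < 5" if "i < 5" for i
    using permutes_in_image[OF p(1), of i] that by simp
  have rows: "set (row E (\<rho> i)) = \<kappa> ` set (C ! (i - 1))" if i: "i \<in> {1..5}" for i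
  proof -
    have "relabel_row k (C ! (i - 1)) = permute_list p (map (row E) [1..<6]) ! (i - 1)"
      unfolding p(2) using i len by (subst nth_map) auto
    also have "\<dots> = map (row E) [1..<6] ! p (i - 1)"
      using i p(1) by (intro permute_list_nth) auto
    also have "\<dots> = row E ([1..<6] ! p (i - 1))"
      using i p_lt by (intro nth_map) auto
    also have "[1..<6] ! p (i - 1) = \<rho> i"
      using i p_lt by (subst nth_upt) (auto simp: \<rho>_def)
    finally have "row E (\<rho> i) = relabel_row k (C ! (i - 1))" ..
    then show ?thesis
      by (simp add: relabel_row_def \<kappa>_def)
  qed
  have "bij_betw (\<lambda>i. i - 1) {1..5} {..<5 :: nat}"
    by (rule bij_betw_byWitness[where f' = Suc]) auto
  moreover have "bij_betw p {..<5} {..<5}"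
    using p(1) by (rule permutes_imp_bij)
  moreover have "bij_betw Suc {..<5} {1..5}"
    by (rule bij_betw_byWitness[where f' = "\<lambda>i. i - 1"]) auto
  ultimately have "bij_betw (Suc \<circ> (p \<circ> (\<lambda>i. i - 1))) {1..5} {1..5}"
    by (intro bij_betw_trans)
  moreover have "Suc \<circ> (p \<circ> (\<lambda>i. i - 1)) = \<rho>"
    by (simp add: fun_eq_iff \<rho>_def)
  ultimately have \<rho>: "bij_betw \<rho> {1..5} {1..5}"
    by simp
  have E_rows: "(i, j) \<in> E \<longleftrightarrow> i \<in> {1..5} \<and> j \<in> set (row E i)" for i j
    using E(1) unfolding set_row cells_def by auto
  have "E = map_prod \<rho> \<kappa> ` cells_of_rows C"
  proof (intro set_eqI iffI)
    fix c assume "c \<in> E"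
    moreover obtain i j where c: "c = (i, j)"
      by (cases c)
    ultimately have ij: "i \<in> {1..5}" "j \<in> set (row E i)"
      using E_rows by auto
    then have "i \<in> \<rho> ` {1..5}"
      by (simp only: bij_betw_imp_surj_on[OF \<rho>])
    then obtain i' where i': "i' \<in> {1..5}" "i = \<rho> i'"
      by blast
    then obtain j' where "j' \<in> set (C ! (i' - 1))" "j = \<kappa> j'"
      using rows ij by auto
    then show "c \<in> map_prod \<rho> \<kappa> ` cells_of_rows C"
      using i' len unfolding c cells_of_rows_def by force
  next
    fix c assume "c \<in> map_prod \<rho> \<kappa> ` cells_of_rows C"
    then obtain i j where c: "c = (\<rho> i, \<kappa> j)" and ij: "i \<in> {1..5}" "j \<in> set (C ! (i - 1))"
      using len by (auto simp: cells_of_rows_def)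
    have "\<rho> i \<in> {1..5}"
      using \<rho> ij(1) by (rule bij_betwE[rule_format])
    moreover have "\<kappa> j \<in> set (row E (\<rho> i))"
      using rows ij by auto
    ultimately show "c \<in> E"
      unfolding c E_rows by blast
  qed
  then show ?thesis
    using that C \<rho> \<kappa> by blast
qed

section \<open>Placed patterns\<close>

text \<open>
  A placement \<open>(t, rs, cs)\<close> sends the rows and columns of a pattern, which is first transposed if \<open>t\<close>
  holds, to the rows \<open>rs\<close> and the columns \<open>cs\<close> of the \<open>5 \<times> 5\<close> grid.
\<close>

type_synonym placement = "bool \<times> nat list \<times> nat list"

fun place :: "placement \<Rightarrow> cell \<Rightarrow> cell" where
  "place (False, rs, cs) (i, j) = (rs ! (i - 1), cs ! (j - 1))"
| "place (True, rs, cs) (i, j) = (rs ! (j - 1), cs ! (i - 1))"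

fun valid_placement :: "nat \<Rightarrow> nat \<Rightarrow> placement \<Rightarrow> bool" where
  "valid_placement m n (t, rs, cs) \<longleftrightarrow>
     length rs = (if t then n else m) \<and> length cs = (if t then m else n) \<and>
     list_all (\<lambda>i. 1 \<le> i \<and> i \<le> 5) rs \<and> list_all (\<lambda>j. 1 \<le> j \<and> j \<le> 5) cs"

lemma reducible_place:
  assumes "reducible m n P" "valid_placement m n s"
  shows "reducible 5 5 (map (map (place s)) P)"
proof -
  obtain t rs cs where s: "s = (t, rs, cs)"
    by (metis prod_cases3)
  have rs: "(\<lambda>i. rs ! (i - 1)) ` {1..length rs} \<subseteq> {1..5}"
    and cs: "(\<lambda>j. cs ! (j - 1)) ` {1..length cs} \<subseteq> {1..5}"
    using assms(2) by (auto simp: s list_all_length)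
  show ?thesis
  proof (cases t)
    case True
    have "place s = map_prod (\<lambda>i. rs ! (i - 1)) (\<lambda>j. cs ! (j - 1)) \<circ> prod.swap"
      by (auto simp: fun_eq_iff s True)
    moreover have "length rs = n" "length cs = m"
      using assms(2) by (simp_all add: s True)
    ultimately show ?thesis
      using reducible_map[OF reducible_transpose[OF assms(1)], of "\<lambda>i. rs ! (i - 1)" 5 "\<lambda>j. cs ! (j - 1)" 5]
        rs cs by (simp only: map_map[symmetric] map_comp_map[symmetric] comp_apply)
  next
    case False
    have "place s = map_prod (\<lambda>i. rs ! (i - 1)) (\<lambda>j. cs ! (j - 1))"
      by (auto simp: fun_eq_iff s False)
    moreover have "length rs = m" "length cs = n"
      using assms(2) by (simp_all add: s False)
    ultimately show ?thesis
      using reducible_map[OF assms(1), of "\<lambda>i. rs ! (i - 1)" 5 "\<lambda>j. cs ! (j - 1)" 5] rs cs by simp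
  qed
qed

type_synonym pattern_table = "(cell list list \<times> nat \<times> nat \<times> placement list) list"

definition placed_patterns :: "pattern_table \<Rightarrow> cell list list list" where
  "placed_patterns T = concat (map (\<lambda>(P, m, n, ss). map (\<lambda>s. map (map (place s)) P) ss) T)"

definition valid_table :: "pattern_table \<Rightarrow> bool" where
  "valid_table T \<longleftrightarrow> list_all (\<lambda>(P, m, n, ss). list_all (valid_placement m n) ss) T"

lemma reducible_placed_patterns:
  assumes "valid_table T" "\<forall>(P, m, n, ss)\<in>set T. reducible m n P" "Q \<in> set (placed_patterns T)"
  shows "reducible 5 5 Q"
  using assms unfolding valid_table_def placed_patterns_def list_all_iff
  by (fastforce intro: reducible_place)

section \<open>Two-edges on the free cells as a propositional problem\<close>

definition row_cells :: "nat list list \<Rightarrow> cell list" where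
  "row_cells C = concat (map (\<lambda>(i, r). map (Pair i) r) (zip [1, 2, 3, 4, 5] C))"

definition free_cells :: "nat list list \<Rightarrow> cell list" where
  "free_cells C = filter (\<lambda>c. c \<notin> set (row_cells C)) (List.product [1, 2, 3, 4, 5] [1, 2, 3, 4, 5])"

fun pairs :: "'a list \<Rightarrow> 'a list list" where
  "pairs [] = []"
| "pairs (x # xs) = map (\<lambda>y. [x, y]) xs @ pairs xs"

lemma pairs_cover: "x \<in> set xs \<Longrightarrow> y \<in> set xs \<Longrightarrow> x \<noteq> y \<Longrightarrow> [x, y] \<in> set (pairs xs) \<or> [y, x] \<in> set (pairs xs)"
  by (induction xs) auto

lemma pairs_elements: "p \<in> set (pairs xs) \<Longrightarrow> \<exists>x y. p = [x, y] \<and> x \<in> set xs \<and> y \<in> set xs"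
  by (induction xs) auto

lemma in_pairsD: "p \<in> set (pairs xs) \<Longrightarrow> distinct xs \<Longrightarrow> \<exists>x y. p = [x, y] \<and> x \<noteq> y \<and> x \<in> set xs \<and> y \<in> set xs"
  by (induction xs) auto

lemma distinct_pairs: "distinct xs \<Longrightarrow> distinct (pairs xs)"
  by (induction xs) (auto simp: distinct_map inj_on_def dest: in_pairsD)

lemma inj_on_set_pairs: "distinct xs \<Longrightarrow> inj_on set (set (pairs xs))"
proof (induction xs)
  case (Cons x xs)
  show ?case
  proof (rule inj_onI)
    fix p q assume pq: "p \<in> set (pairs (x # xs))" "q \<in> set (pairs (x # xs))" "set p = set q"
    show "p = q"
    proof (cases "x \<in> set p")
      case True
      then show ?thesis
        using pq Cons.prems by (auto dest!: in_pairsD simp: doubleton_eq_iff)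
    next
      case False
      then have "p \<in> set (pairs xs)" "q \<in> set (pairs xs)"
        using pq by auto
      then show ?thesis
        using Cons pq(3) by (auto dest: inj_onD)
    qed
  qed
qed simp

text \<open>Orients an edge lexicographically, as \<open>pairs (free_cells C)\<close> lists it, so
  that every two-edge corresponds to a single propositional atom.\<close>

definition sorted_edge :: "cell list \<Rightarrow> cell list" where
  "sorted_edge p = (case p of [(i, j), (k, l)] \<Rightarrow> if i < k \<or> i = k \<and> j < l then p else [(k, l), (i, j)] | _ \<Rightarrow> p)"

lemma set_sorted_edge [simp]: "set (sorted_edge p) = set p"
  unfolding sorted_edge_def by (auto split: list.splits)

text \<open>
  \<open>S\<close> stands for the set of two-edges, an edge being listed as an element of \<open>pairs (free_cells C)\<close>,
  and \<open>K\<close> for the set of cells covered by them. Six disjoint two-edges cover all but one of the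
  thirteen free cells. The last condition excludes the two-edges of every placed pattern.
\<close>

definition matching_clauses :: "nat list list \<Rightarrow> pattern_table \<Rightarrow> (cell list \<Rightarrow> bool) \<Rightarrow> (cell \<Rightarrow> bool) \<Rightarrow> bool" where
  "matching_clauses C T S K \<longleftrightarrow>
     list_all (\<lambda>p. K (p ! 0) \<or> K (p ! 1)) (pairs (free_cells C)) \<and>
     list_all (\<lambda>u. K u \<longleftrightarrow> list_ex S (filter (\<lambda>p. u \<in> set p) (pairs (free_cells C)))) (free_cells C) \<and>
     list_all (\<lambda>u. list_all (\<lambda>ps. \<not> list_all S ps) (pairs (filter (\<lambda>p. u \<in> set p) (pairs (free_cells C)))))
       (free_cells C) \<and>
     list_all (\<lambda>ps. \<not> list_all S ps)
       (map (\<lambda>P. map sorted_edge (filter (\<lambda>p. length p = 2) P)) (placed_patterns T))"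

text \<open>The single cells of a placed pattern lie in the extremal set and are one-edges already;
  the pattern thus occurs as soon as its two-edges are selected. Distinctness of all its cells makes
  its edges disjoint.\<close>

definition applicable_table :: "nat list list \<Rightarrow> pattern_table \<Rightarrow> bool" where
  "applicable_table C T \<longleftrightarrow> valid_table T \<and>
     list_all (\<lambda>P. distinct (concat P) \<and>
       list_all (\<lambda>p. length p = 2 \<and> list_all (\<lambda>c. c \<in> set (free_cells C)) p \<or>
         length p = 1 \<and> hd p \<in> set (row_cells C)) P) (placed_patterns T)"

definition table_A :: pattern_table where
  "table_A = [
    (pattern1, 2, 3, [
      (False, [1, 4], [2, 3, 5]), (True, [4, 1, 3], [3, 2]), (True, [2, 1, 5], [3, 1]),
      (False, [1, 5], [1, 4, 5]), (True, [5, 1, 2], [4, 1]), (True, [3, 1, 4], [4, 2]),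
      (True, [5, 1, 2], [5, 1]), (True, [4, 1, 3], [5, 2]), (False, [2, 4], [3, 2, 5]),
      (True, [1, 2, 5], [2, 1]), (False, [2, 5], [1, 4, 5]), (False, [3, 5], [4, 1, 5]),
      (True, [1, 3, 4], [1, 2]), (False, [3, 4], [2, 3, 5]), (False, [4, 5], [5, 1, 4]),
      (False, [5, 4], [5, 2, 3])]),
    (pattern2, 3, 3, [
      (False, [1, 3, 4], [2, 3, 5]), (False, [1, 2, 5], [1, 4, 5]),
      (False, [1, 2, 5], [1, 5, 4]), (False, [1, 3, 4], [2, 5, 3])]),
    (pattern3, 3, 3, [
      (False, [2, 3, 4], [3, 4, 2])]),
    (pattern4, 3, 2, [
      (True, [2, 1], [3, 2, 1]), (False, [1, 4, 2], [1, 3]), (True, [3, 1], [4, 1, 2]),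
      (True, [5, 1], [4, 2, 1]), (True, [4, 1], [5, 1, 2]), (True, [5, 1], [5, 2, 1]),
      (False, [2, 3, 1], [1, 2]), (False, [2, 3, 4], [3, 2]), (False, [2, 4, 1], [1, 2]),
      (False, [2, 3, 5], [1, 4]), (True, [5, 2], [4, 3, 1]), (True, [4, 2], [5, 1, 3]),
      (True, [5, 2], [5, 3, 1]), (False, [3, 5, 1], [2, 1]), (True, [4, 3], [3, 4, 2]),
      (True, [4, 3], [5, 4, 2]), (False, [3, 5, 4], [2, 5]), (False, [4, 5, 1], [2, 1]),
      (False, [4, 5, 2], [3, 1]), (False, [4, 5, 3], [2, 4]), (True, [5, 4], [4, 3, 5])]),
    (pattern5, 3, 4, [
      (False, [1, 2, 5], [1, 2, 3, 4]), (False, [1, 5, 2], [1, 2, 4, 3]),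
      (False, [1, 3, 4], [2, 1, 4, 3]), (False, [1, 4, 3], [2, 1, 3, 4]),
      (False, [3, 4, 1], [2, 4, 3, 1]), (False, [2, 1, 5], [1, 3, 2, 4]),
      (False, [3, 1, 4], [2, 4, 1, 3]), (False, [2, 5, 1], [1, 3, 4, 2]),
      (True, [4, 2, 3, 5], [3, 2, 5]), (True, [4, 5, 2, 3], [5, 3, 2]),
      (True, [5, 4, 2, 3], [5, 1, 4]), (True, [5, 3, 2, 4], [4, 1, 5]),
      (True, [5, 3, 4, 2], [4, 5, 1]), (True, [5, 4, 3, 2], [5, 4, 1]),
      (True, [4, 5, 3, 2], [5, 2, 3]), (True, [4, 2, 5, 3], [3, 5, 2])]),
    (pattern6, 4, 3, [
      (False, [1, 2, 3, 4], [2, 3, 4]), (False, [1, 2, 5, 4], [5, 3, 4]),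
      (False, [3, 1, 4, 5], [5, 1, 3]), (False, [1, 3, 4, 5], [5, 4, 3]),
      (True, [5, 4, 1], [4, 3, 1, 5]), (False, [1, 5, 4, 3], [2, 4, 3]),
      (True, [4, 5, 1], [3, 4, 2, 5]), (True, [3, 5, 1], [3, 5, 2, 4]),
      (False, [2, 1, 5, 4], [5, 2, 4]), (True, [2, 4, 1], [4, 5, 1, 3]),
      (False, [2, 1, 5, 3], [4, 2, 5]), (False, [3, 1, 4, 2], [3, 1, 5]),
      (True, [4, 2, 3], [5, 1, 2, 3]), (True, [1, 2, 3], [5, 3, 2, 1]),
      (False, [2, 3, 5, 1], [1, 2, 5]), (True, [5, 4, 2], [4, 2, 1, 5]),
      (False, [2, 4, 5, 1], [1, 2, 4]), (True, [4, 5, 2], [2, 4, 3, 5]),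
      (False, [5, 3, 2, 1], [1, 2, 3]), (True, [1, 3, 2], [5, 4, 1, 2]),
      (True, [4, 3, 2], [5, 4, 3, 2]), (True, [1, 4, 2], [4, 5, 1, 2]),
      (False, [4, 2, 3, 1], [2, 1, 4]), (False, [3, 2, 4, 1], [2, 1, 5]),
      (True, [5, 4, 3], [1, 3, 4, 5]), (False, [3, 5, 4, 1], [2, 1, 3]),
      (True, [4, 5, 3], [3, 1, 2, 5]), (True, [1, 5, 3], [3, 5, 2, 1])]),
    (pattern7, 3, 3, [
      (False, [1, 2, 4], [1, 3, 4]), (False, [2, 4, 1], [3, 2, 4]),
      (False, [1, 5, 3], [1, 4, 3]), (False, [3, 1, 5], [2, 1, 3]),
      (False, [1, 4, 2], [2, 3, 4]), (False, [1, 5, 4], [4, 5, 3]),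
      (False, [4, 2, 1], [3, 1, 4]), (False, [1, 3, 5], [2, 4, 3]),
      (False, [5, 1, 3], [1, 2, 3]), (False, [2, 1, 4], [1, 2, 4]),
      (False, [3, 5, 1], [4, 1, 3]), (False, [4, 1, 2], [2, 1, 4]),
      (False, [1, 4, 5], [3, 5, 4]), (False, [5, 3, 1], [4, 2, 3]),
      (False, [2, 1, 3], [1, 2, 5]), (False, [3, 1, 2], [2, 1, 5]),
      (False, [2, 5, 3], [5, 4, 2]), (False, [2, 3, 4], [4, 2, 5]),
      (False, [2, 4, 3], [5, 2, 4]), (False, [2, 5, 4], [4, 5, 2]),
      (False, [2, 3, 5], [2, 4, 5]), (False, [2, 4, 5], [2, 5, 4]),
      (False, [3, 4, 2], [5, 3, 1]), (False, [3, 2, 5], [3, 1, 5]),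
      (False, [3, 5, 2], [5, 1, 3]), (False, [3, 2, 4], [1, 3, 5]),
      (False, [3, 4, 5], [3, 5, 1]), (False, [3, 5, 4], [1, 5, 3])]),
    (pattern8, 3, 4, [
      (False, [1, 2, 5], [1, 2, 3, 4]), (False, [1, 2, 5], [1, 2, 3, 5]),
      (False, [3, 1, 4], [2, 4, 1, 3]), (False, [1, 4, 3], [2, 1, 3, 4]),
      (False, [5, 1, 2], [1, 4, 2, 3]), (False, [5, 1, 2], [1, 5, 2, 3]),
      (False, [1, 3, 4], [2, 1, 4, 3]), (False, [1, 3, 4], [2, 1, 4, 5]),
      (False, [4, 1, 3], [2, 5, 1, 4]), (False, [1, 5, 2], [1, 2, 4, 3]),
      (False, [1, 4, 3], [2, 1, 5, 4]), (True, [4, 2, 5, 1], [3, 5, 2]),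
      (True, [4, 5, 3, 2], [5, 2, 3]), (True, [4, 3, 2, 5], [2, 3, 5]),
      (True, [5, 4, 3, 2], [5, 4, 1]), (True, [5, 3, 2, 4], [4, 1, 5]),
      (True, [5, 3, 4, 2], [4, 5, 1]), (True, [4, 3, 5, 2], [2, 5, 3])]),
    (pattern9, 3, 5, [
      (False, [1, 3, 4], [1, 2, 3, 4, 5]), (True, [4, 5, 2, 3, 1], [5, 4, 1]),
      (True, [2, 4, 1, 5, 3], [3, 5, 2]), (False, [1, 2, 5], [2, 1, 4, 3, 5]),
      (True, [5, 4, 3, 2, 1], [5, 3, 2]), (True, [3, 5, 1, 4, 2], [4, 5, 1]),
      (False, [2, 1, 5], [3, 1, 5, 2, 4]), (False, [3, 1, 4], [4, 2, 5, 1, 3])])]"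

definition base_table_B :: pattern_table where
  "base_table_B = [
    (pattern1, 2, 3, [
      (False, [1, 5], [1, 2, 3]), (True, [2, 1, 3], [2, 5])]),
    (pattern4, 3, 2, [
      (True, [2, 1], [2, 1, 5]), (False, [1, 5, 2], [5, 2])]),
    (pattern8, 3, 4, [
      (False, [1, 2, 3], [5, 1, 2, 3]), (False, [3, 1, 2], [5, 3, 4, 2])]),
    (pattern10, 4, 4, [
      (False, [1, 2, 3, 5], [1, 2, 3, 4]), (True, [3, 2, 1, 4], [3, 2, 1, 5])]),
    (pattern11, 4, 4, [
      (False, [1, 2, 3, 4], [5, 1, 3, 4]), (True, [5, 3, 1, 4], [3, 2, 1, 4])]),
    (pattern12, 4, 4, [
      (False, [1, 2, 3, 4], [5, 2, 3, 4]), (True, [5, 2, 1, 4], [3, 2, 1, 4])]),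
    (pattern13, 4, 4, [
      (False, [1, 2, 4, 3], [1, 2, 4, 3])])]"

text \<open>
  The cells of \<open>rows_B\<close> are \<open>(v, v)\<close>, \<open>(v, 5)\<close> and \<open>(5, v)\<close> for \<open>v \<le> 4\<close>, so every placement can be
  composed with a simultaneous permutation of the first four rows and columns.
\<close>

fun insertions :: "'a \<Rightarrow> 'a list \<Rightarrow> 'a list list" where
  "insertions x [] = [[x]]"
| "insertions x (y # ys) = (x # y # ys) # map ((#) y) (insertions x ys)"

definition vertex_permutations :: "nat list list" where
  "vertex_permutations =
     map (\<lambda>\<pi>. \<pi> @ [5]) (foldr (\<lambda>x \<pi>s. concat (map (insertions x) \<pi>s)) [1, 2, 3, 4] [[]])"

definition table_B :: pattern_table where
  "table_B = map (\<lambda>(P, m, n, ss). (P, m, n, concat (map (\<lambda>(t, rs, cs).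
     map (\<lambda>\<pi>. (t, map (\<lambda>i. \<pi> ! (i - 1)) rs, map (\<lambda>j. \<pi> ! (j - 1)) cs)) vertex_permutations) ss)))
     base_table_B"

lemma applicable_table_A: "applicable_table rows_A table_A"
  by code_simp

lemma applicable_table_B: "applicable_table rows_B table_B"
  by code_simp

lemmas pattern_defs = pattern1_def pattern2_def pattern3_def pattern4_def pattern5_def pattern6_def pattern7_def
  pattern8_def pattern9_def pattern10_def pattern11_def pattern12_def pattern13_def

lemmas clause_evaluation = free_cells_def row_cells_def rows_A_def rows_B_def placed_patterns_def table_A_def table_B_def
  base_table_B_def vertex_permutations_def pattern_defs sorted_edge_def

text \<open>Evaluating the lists leaves a propositional formula in 78 atoms for \<open>S\<close> and
  13 for \<open>K\<close>. The auxiliary \<open>K\<close> reduces "at most one free cell is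
  uncovered" to binary clauses. Its unsatisfiability is also what shows that the table has enough
  placements.\<close>

lemma no_matching_A:
  assumes "matching_clauses rows_A table_A S K"
  shows False
proof -
  note clause_evaluation [simp]
  note clauses = assms[unfolded matching_clauses_def]
  show ?thesis
    using clauses[THEN conjunct1, simplified]
      clauses[THEN conjunct2, THEN conjunct1, simplified]
      clauses[THEN conjunct2, THEN conjunct2, THEN conjunct1, simplified]
      clauses[THEN conjunct2, THEN conjunct2, THEN conjunct2, simplified]
    by sat
qed

lemma no_matching_B:
  assumes "matching_clauses rows_B table_B S K"
  shows False
proof -
  note clause_evaluation [simp]
  note clauses = assms[unfolded matching_clauses_def]
  show ?thesis
    using clauses[THEN conjunct1, simplified]
      clauses[THEN conjunct2, THEN conjunct1, simplified]
      clauses[THEN conjunct2, THEN conjunct2, THEN conjunct1, simplified]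
      clauses[THEN conjunct2, THEN conjunct2, THEN conjunct2, simplified]
    by sat
qed

section \<open>An admissible configuration with 17 edges\<close>

lemma same_edge_unique:
  assumes "simple_configuration G" "e \<in> selected_edges G" "f \<in> selected_edges G" "p \<in> e" "p \<in> f"
  shows "e = f"
  using assms unfolding simple_configuration_def by blast

text \<open>Every rule that creates an equivalence between different cells requires them to be
  paired, every rule that creates an orthogonality requires them not to be, and the closure rules
  respect the disjoint edges. So in a simple configuration different edges never share a
  class.\<close>

lemma rw_sim_imp_same_edge:
  assumes G: "augmented_configuration m n G" "simple_configuration G"
  shows "rw_sim G p q \<Longrightarrow> \<exists>e\<in>selected_edges G. p \<in> e \<and> q \<in> e"
    and "rw_perp G p' q' \<Longrightarrow> \<not> (\<exists>e\<in>selected_edges G. p' \<in> e \<and> q' \<in> e)"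
proof (induction rule: rw_sim_rw_perp.inducts)
  case (sim_refl p)
  then show ?case
    by (auto simp: occupied_def)
next
  case (sim_trans p q r)
  then show ?case
    using same_edge_unique[OF G(2)] by metis
next
  case (line_sim p q)
  then show ?case
    using same_edge_iff_paired[OF G(1)] by blast
next
  case (line_perp p q)
  then show ?case
    using same_edge_iff_paired[OF G(1)] by blast
next
  case (saturation p p' q q')
  then show ?case
    using same_edge_unique[OF G(2)] by metis
next
  case (transfer_perp i k j l)
  then show ?case
    using same_edge_iff_paired[OF G(1), of "(i, j)" "(k, l)"] by simp
next
  case (transfer_sim i k j l)
  then show ?case
    using same_edge_iff_paired[OF G(1), of "(i, j)" "(k, l)"] by simp
next
  case (complementary_pair i k j l)
  then show ?case
    using same_edge_iff_paired[OF G(1), of "(i, j)" "(k, l)"] by simp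
qed auto

section \<open>An executable check of derivations by the recursive rules\<close>

definition configuration_of :: "cell list \<Rightarrow> (cell \<times> cell) list \<Rightarrow> configuration" where
  "configuration_of A T = \<lparr>one_edges = set A, two_edges = (\<lambda>(p, q). {p, q}) ` set T\<rparr>"

definition occupied_cells :: "cell list \<Rightarrow> (cell \<times> cell) list \<Rightarrow> cell list" where
  "occupied_cells A T = A @ map fst T @ map snd T"

definition in_list :: "cell \<Rightarrow> cell \<Rightarrow> (cell \<times> cell) list \<Rightarrow> bool" where
  "in_list p q T \<longleftrightarrow> (p, q) \<in> set T \<or> (q, p) \<in> set T"

text \<open>\<open>S\<close> collects equivalences between the halves of two-edges. Disjoint
  two-edges give classes of at most two cells, so one step along \<open>S\<close> replaces the
  transitive closure.\<close>

definition class_of :: "(cell \<times> cell) list \<Rightarrow> cell \<Rightarrow> cell list" where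
  "class_of S p = p # map snd (filter (\<lambda>s. fst s = p) S) @ map fst (filter (\<lambda>s. snd s = p) S)"

text \<open>The line rule and saturation are built into the test, so that derivations list only what
  rectangle transfers add.\<close>

definition derived_perp :: "cell list \<Rightarrow> (cell \<times> cell) list \<Rightarrow> (cell \<times> cell) list \<Rightarrow> (cell \<times> cell) list \<Rightarrow> cell \<Rightarrow> cell \<Rightarrow> bool" where
  "derived_perp A T S D p q \<longleftrightarrow> list_ex (\<lambda>a. list_ex (\<lambda>b. in_list a b D \<or>
       (fst a = fst b \<or> snd a = snd b) \<and> a \<noteq> b \<and> \<not> in_list a b T) (class_of S q)) (class_of S p)"

definition derived_certified :: "cell list \<Rightarrow> (cell \<times> cell) list \<Rightarrow> (cell \<times> cell) list \<Rightarrow> (cell \<times> cell) list \<Rightarrow> cell \<Rightarrow> cell \<Rightarrow> bool" where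
  "derived_certified A T S D r s \<longleftrightarrow>
     (if in_list r s T then in_list r s S
      else r \<notin> set (occupied_cells A T) \<or> s \<notin> set (occupied_cells A T) \<or> derived_perp A T S D r s)"

text \<open>A derivation is a list of steps \<open>(True, p, q)\<close> for \<open>p \<sim> q\<close> and \<open>(False, p, q)\<close> for \<open>p \<bottom>\<^sub>R q\<close>.\<close>

fun derivation :: "cell list \<Rightarrow> (cell \<times> cell) list \<Rightarrow> (cell \<times> cell) list \<Rightarrow> (cell \<times> cell) list \<Rightarrow> (bool \<times> cell \<times> cell) list \<Rightarrow> bool" where
  "derivation A T S D [] \<longleftrightarrow>
     list_all (\<lambda>t. t \<in> set S) T \<and>
     list_all (\<lambda>ef. list_ex (\<lambda>p. list_ex (\<lambda>q. derived_perp A T S D p q) (ef ! 1)) (ef ! 0))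
       (pairs (map (\<lambda>c. [c]) A @ map (\<lambda>(p, q). [p, q]) T))"
| "derivation A T S D ((b, (i, j), (k, l)) # ds) \<longleftrightarrow>
     (if b then ((i, j), (k, l)) \<in> set T \<and>
          (i = k \<or> j = l \<or> derived_certified A T S D (i, l) (k, j)) \<and>
          derivation A T (((i, j), (k, l)) # S) D ds
      else (i, j) \<in> set (occupied_cells A T) \<and> (k, l) \<in> set (occupied_cells A T) \<and>
          i \<noteq> k \<and> j \<noteq> l \<and> \<not> in_list (i, j) (k, l) T \<and> derived_certified A T S D (i, l) (k, j) \<and>
          derivation A T S (((i, j), (k, l)) # D) ds)"

lemma occupied_configuration_of: "occupied (configuration_of A T) = set (occupied_cells A T)"
  by (force simp: occupied_def selected_edges_def configuration_of_def occupied_cells_def)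

lemma paired_configuration_of: "paired (configuration_of A T) p q \<longleftrightarrow> in_list p q T"
proof -
  have "{p, q} = (case t of (a, b) \<Rightarrow> {a, b}) \<longleftrightarrow> t = (p, q) \<or> t = (q, p)" for t
    by (cases t) (auto simp only: prod.case doubleton_eq_iff prod.inject)
  then have "{p, q} \<in> (\<lambda>(a, b). {a, b}) ` set T \<longleftrightarrow> (\<exists>t\<in>set T. t = (p, q) \<or> t = (q, p))"
    unfolding image_iff by (rule bex_cong[OF refl])
  then show ?thesis
    unfolding paired_def configuration_of_def in_list_def by simp blast
qed

lemma rw_sim_occupied:
  assumes "rw_sim G p q"
  shows "p \<in> occupied G \<and> q \<in> occupied G"
  using assms
  by (induction rule: rw_sim_rw_perp.inducts(1)[where ?P2.0 = "\<lambda>_ _. True"])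
    (auto dest: paired_occupied)

lemma derived_perp_sound:
  assumes "\<forall>(p, q)\<in>set S. rw_sim (configuration_of A T) p q" "\<forall>(p, q)\<in>set D. rw_perp (configuration_of A T) p q"
    and "derived_perp A T S D p q" "p \<in> set (occupied_cells A T)" "q \<in> set (occupied_cells A T)"
  shows "rw_perp (configuration_of A T) p q"
proof -
  let ?G = "configuration_of A T"
  have class_sim: "rw_sim ?G p a" if "a \<in> set (class_of S p)" "p \<in> set (occupied_cells A T)" for a p
  proof -
    have "rw_sim ?G a b" if "(a, b) \<in> set S" for a b
      using assms(1) that by blast
    then show ?thesis
      using that sim_refl[of p ?G] unfolding class_of_def occupied_configuration_of
      by (auto intro: sim_sym)
  qed
  obtain a b where ab: "a \<in> set (class_of S p)" "b \<in> set (class_of S q)"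
    "in_list a b D \<or> (fst a = fst b \<or> snd a = snd b) \<and> a \<noteq> b \<and> \<not> in_list a b T"
    using assms(3) unfolding derived_perp_def list_ex_iff by blast
  have sim: "rw_sim ?G p a" "rw_sim ?G q b"
    using ab assms class_sim by blast+
  have "rw_perp ?G a b"
  proof (cases "in_list a b D")
    case True
    then show ?thesis
      using assms(2) unfolding in_list_def by (auto intro: perp_sym)
  next
    case False
    then show ?thesis
      using ab(3) sim[THEN rw_sim_occupied] by (intro line_perp) (auto simp: paired_configuration_of)
  qed
  then show ?thesis
    using sim by (rule saturation[rotated 2])
qed

lemma derived_certified_sound:
  assumes "\<forall>(p, q)\<in>set S. rw_sim (configuration_of A T) p q" "\<forall>(p, q)\<in>set D. rw_perp (configuration_of A T) p q"
    and "derived_certified A T S D r s"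
  shows "(\<not> paired (configuration_of A T) r s \<and> (r \<notin> occupied (configuration_of A T) \<or>
      s \<notin> occupied (configuration_of A T) \<or> rw_perp (configuration_of A T) r s)) \<or>
    (paired (configuration_of A T) r s \<and> rw_sim (configuration_of A T) r s)"
proof (cases "in_list r s T")
  case True
  then have "in_list r s S"
    using assms(3) unfolding derived_certified_def by simp
  then have "rw_sim (configuration_of A T) r s"
    using assms(1) unfolding in_list_def by (auto intro: sim_sym)
  with True show ?thesis
    by (simp add: paired_configuration_of)
next
  case False
  then show ?thesis
    using assms derived_perp_sound[OF assms(1,2)]
    unfolding derived_certified_def paired_configuration_of occupied_configuration_of by auto
qed

lemma derivation_sound:
  assumes "derivation A T S D ds"
    and "\<forall>(p, q)\<in>set S. rw_sim (configuration_of A T) p q" "\<forall>(p, q)\<in>set D. rw_perp (configuration_of A T) p q"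
  shows "(\<forall>(p, q)\<in>set T. rw_sim (configuration_of A T) p q) \<and>
    list_all (\<lambda>ef. \<exists>p\<in>set (ef ! 0). \<exists>q\<in>set (ef ! 1). rw_perp (configuration_of A T) p q)
       (pairs (map (\<lambda>c. [c]) A @ map (\<lambda>(p, q). [p, q]) T))"
  using assms
proof (induction A T S D ds rule: derivation.induct)
  case (1 A T S D)
  let ?es = "map (\<lambda>c. [c]) A @ map (\<lambda>(p, q). [p, q]) T"
  have occupied: "p \<in> set (occupied_cells A T)" if ef: "ef \<in> set (pairs ?es)" "p \<in> set (ef ! 0) \<union> set (ef ! 1)" for ef p
  proof -
    obtain x y where "ef = [x, y]" "x \<in> set ?es" "y \<in> set ?es"
      using pairs_elements[OF ef(1)] by blast
    then show ?thesis
      using ef(2) unfolding occupied_cells_def by force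
  qed
  have "\<exists>p\<in>set (ef ! 0). \<exists>q\<in>set (ef ! 1). rw_perp (configuration_of A T) p q"
    if ef: "ef \<in> set (pairs ?es)" for ef
  proof -
    have "list_ex (\<lambda>p. list_ex (\<lambda>q. derived_perp A T S D p q) (ef ! 1)) (ef ! 0)"
      using 1(1) ef unfolding derivation.simps list_all_iff by blast
    then obtain p q where pq: "p \<in> set (ef ! 0)" "q \<in> set (ef ! 1)" "derived_perp A T S D p q"
      unfolding list_ex_iff by blast
    then have "rw_perp (configuration_of A T) p q"
      using derived_perp_sound[OF 1(2,3)] occupied[OF ef] by blast
    with pq show ?thesis
      by blast
  qed
  moreover have "\<forall>(p, q)\<in>set T. rw_sim (configuration_of A T) p q"
    using 1(1,2) unfolding derivation.simps list_all_iff by blast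
  ultimately show ?case
    unfolding list_all_iff by blast
next
  case (2 A T S D b i j k l ds)
  show ?case
  proof (cases b)
    case True
    have T: "((i, j), (k, l)) \<in> set T"
      using 2(3) True by simp
    then have occ: "(i, j) \<in> occupied (configuration_of A T)" "(k, l) \<in> occupied (configuration_of A T)"
      and paired: "paired (configuration_of A T) (i, j) (k, l)"
      by (force simp: occupied_configuration_of occupied_cells_def paired_configuration_of in_list_def)+
    have "rw_sim (configuration_of A T) (i, j) (k, l)"
    \<comment> \<open>\<open>T\<close> is an arbitrary list here and might pair a cell with
      itself.\<close>
    proof (cases "(i, j) = (k, l)")
      case True
      with occ show ?thesis
        by (metis sim_refl)
    next
      case neq: False
      show ?thesis
      proof (cases "i = k \<or> j = l")
        case True
        with neq occ paired show ?thesis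
          by (intro line_sim) auto
      next
        case False
        then have "derived_certified A T S D (i, l) (k, j)"
          using 2(3) \<open>b\<close> by simp
        with False paired show ?thesis
          by (intro transfer_sim derived_certified_sound[OF 2(4,5)]) auto
      qed
    qed
    with True 2 show ?thesis
      by simp
  next
    case False
    then have "rw_perp (configuration_of A T) (i, j) (k, l)"
      using 2(3)
      by (intro transfer_perp derived_certified_sound[OF 2(4,5)])
        (auto simp: occupied_configuration_of paired_configuration_of)
    with False 2 show ?thesis
      by simp
  qed
qed

text \<open>Three free cells, \<open>(1, 3)\<close>, \<open>(2, 2)\<close> and
  \<open>(3, 5)\<close>, stay empty. A rectangle with an empty corner certifies the diagonal through
  it at once, which starts the derivation.\<close>

definition two_edges_17 :: "(cell \<times> cell) list" where
  "two_edges_17 = [((1, 4), (5, 3)), ((1, 5), (3, 1)), ((2, 4), (4, 4)), ((2, 5), (5, 2)), ((3, 3), (4, 1))]"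

text \<open>The two-edge \<open>(3, 3)\<close>, \<open>(4, 1)\<close> has to wait: its opposite
  diagonal is \<open>(3, 1)\<close>, \<open>(4, 3)\<close>, certified through the equivalence of
  \<open>(3, 1)\<close> with \<open>(1, 5)\<close> and the derived orthogonality of
  \<open>(4, 3)\<close> and \<open>(1, 5)\<close>.\<close>

definition derivation_17 :: "(bool \<times> cell \<times> cell) list" where
  "derivation_17 = [
    (True, (1, 4), (5, 3)), (True, (1, 5), (3, 1)), (True, (2, 4), (4, 4)),
    (True, (2, 5), (5, 2)), (False, (1, 1), (2, 3)), (False, (1, 1), (3, 2)),
    (False, (1, 1), (3, 4)), (False, (1, 1), (4, 3)), (False, (1, 1), (4, 5)),
    (False, (1, 1), (5, 4)), (False, (1, 1), (5, 5)), (False, (1, 1), (2, 5)),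
    (False, (1, 2), (2, 1)), (False, (1, 2), (2, 3)), (False, (1, 2), (4, 3)),
    (False, (1, 2), (5, 1)), (False, (1, 2), (5, 4)), (False, (1, 2), (5, 5)),
    (False, (1, 2), (2, 4)), (False, (1, 2), (3, 3)), (False, (2, 1), (3, 2)),
    (False, (2, 1), (4, 2)), (False, (2, 1), (5, 5)), (False, (2, 3), (3, 2)),
    (False, (2, 3), (4, 2)), (False, (2, 3), (5, 4)), (False, (2, 3), (5, 5)),
    (False, (2, 3), (1, 5)), (False, (3, 2), (4, 5)), (False, (3, 2), (5, 1)),
    (False, (3, 2), (5, 5)), (False, (3, 2), (2, 4)), (False, (3, 4), (4, 2)),
    (False, (3, 4), (4, 5)), (False, (3, 4), (5, 5)), (False, (3, 4), (2, 5)),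
    (False, (4, 2), (5, 4)), (False, (4, 2), (5, 5)), (False, (4, 2), (1, 4)),
    (False, (4, 3), (5, 4)), (False, (4, 3), (1, 5)), (False, (4, 3), (5, 2)),
    (False, (5, 4), (1, 5)), (False, (5, 4), (3, 3)), (False, (5, 5), (2, 4)),
    (False, (5, 5), (3, 3)), (False, (1, 5), (2, 4)), (False, (2, 5), (3, 3)),
    (True, (3, 3), (4, 1)), (False, (1, 1), (4, 2)), (False, (1, 1), (4, 4)),
    (False, (2, 1), (3, 4)), (False, (2, 1), (4, 3)), (False, (2, 1), (4, 5)),
    (False, (2, 1), (1, 4)), (False, (2, 3), (3, 4)), (False, (2, 3), (4, 5)),
    (False, (2, 3), (5, 1)), (False, (3, 2), (4, 3)), (False, (3, 2), (5, 4)),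
    (False, (3, 2), (5, 3)), (False, (3, 4), (4, 3)), (False, (3, 4), (5, 1)),
    (False, (4, 2), (5, 1)), (False, (4, 2), (3, 1)), (False, (4, 3), (5, 1)),
    (False, (4, 5), (5, 1)), (False, (4, 5), (5, 4)), (False, (4, 5), (1, 4)),
    (False, (5, 1), (4, 4)), (False, (1, 2), (3, 4)), (False, (1, 2), (4, 5)),
    (False, (2, 1), (5, 4)), (False, (4, 3), (5, 5))]"

lemma derivation_17: "derivation (row_cells rows_A) two_edges_17 [] [] derivation_17"
  by code_simp

abbreviation configuration_17 :: configuration where
  "configuration_17 \<equiv> configuration_of (row_cells rows_A) two_edges_17"

lemma two_edges_configuration_17:
  "two_edges configuration_17 = {{(1, 4), (5, 3)}, {(1, 5), (3, 1)}, {(2, 4), (4, 4)}, {(2, 5), (5, 2)}, {(3, 3), (4, 1)}}"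
  by (simp add: configuration_of_def two_edges_17_def)

lemma one_edges_configuration_17:
  "one_edges configuration_17 = {(1, 1), (1, 2), (2, 1), (2, 3), (3, 2), (3, 4), (4, 2), (4, 3), (4, 5), (5, 1), (5, 4), (5, 5)}"
  by (simp add: configuration_of_def row_cells_def rows_A_def)

lemma augmented_configuration_17: "augmented_configuration 5 5 configuration_17"
  unfolding augmented_configuration_def one_edges_configuration_17 two_edges_configuration_17 cells_def
  by simp

lemma simple_configuration_17: "simple_configuration configuration_17"
  unfolding simple_configuration_def selected_edges_def one_edges_configuration_17 two_edges_configuration_17
  by simp

lemma num_squares_configuration_17: "num_squares configuration_17 = 17"
  unfolding num_squares_def one_edges_configuration_17 two_edges_configuration_17
  by (simp add: doubleton_eq_iff)

lemma C4_free_configuration_17: "C4_free (one_edges configuration_17)"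
proof -
  let ?E = "one_edges configuration_17"
  have opposite: "\<forall>c\<in>?E. \<forall>d\<in>?E. fst c \<noteq> fst d \<longrightarrow> snd c \<noteq> snd d \<longrightarrow> (fst c, snd d) \<notin> ?E \<or> (fst d, snd c) \<notin> ?E"
    unfolding one_edges_configuration_17 by simp
  show ?thesis
    unfolding C4_free_def
  proof (intro notI, elim exE conjE)
    fix i k j l
    assume "i \<noteq> k" "j \<noteq> l" "{(i, j), (i, l), (k, j), (k, l)} \<subseteq> ?E"
    then show False
      using opposite[rule_format, of "(i, j)" "(k, l)"] by simp
  qed
qed

lemma admissible_configuration_17: "RW3_plus_admissible configuration_17"
proof -
  let ?G = configuration_17 and ?es = "map (\<lambda>c. [c]) (row_cells rows_A) @ map (\<lambda>(p, q). [p, q]) two_edges_17"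
  have sim: "\<forall>(p, q)\<in>set two_edges_17. rw_sim ?G p q"
    and perp: "list_all (\<lambda>ef. \<exists>p\<in>set (ef ! 0). \<exists>q\<in>set (ef ! 1). rw_perp ?G p q) (pairs ?es)"
    using derivation_sound[OF derivation_17] by simp_all
  have edges: "selected_edges ?G = set (map set ?es)"
    by (simp add: selected_edges_def configuration_of_def image_Un image_image case_prod_unfold)
  have "\<exists>p\<in>e. \<exists>q\<in>f. rw_perp ?G p q" if "e \<in> selected_edges ?G" "f \<in> selected_edges ?G" "e \<noteq> f" for e f
  proof -
    obtain a b where ab: "a \<in> set ?es" "e = set a" "b \<in> set ?es" "f = set b"
      using \<open>e \<in> selected_edges ?G\<close> \<open>f \<in> selected_edges ?G\<close> unfolding edges set_map by (elim imageE)
    then have "[a, b] \<in> set (pairs ?es) \<or> [b, a] \<in> set (pairs ?es)"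
      using \<open>e \<noteq> f\<close> by (intro pairs_cover) auto
    then show ?thesis
    proof
      assume "[a, b] \<in> set (pairs ?es)"
      with perp have "\<exists>p\<in>set ([a, b] ! 0). \<exists>q\<in>set ([a, b] ! 1). rw_perp ?G p q"
        unfolding list_all_iff by (rule bspec)
      then show ?thesis
        by (simp add: ab)
    next
      assume "[b, a] \<in> set (pairs ?es)"
      with perp have "\<exists>p\<in>set ([b, a] ! 0). \<exists>q\<in>set ([b, a] ! 1). rw_perp ?G p q"
        unfolding list_all_iff by (rule bspec)
      then show ?thesis
        by (auto simp: ab intro: perp_sym)
    qed
  qed
  moreover have "\<not> rw_sim ?G p q"
    if "e \<in> selected_edges ?G" "f \<in> selected_edges ?G" "e \<noteq> f" "p \<in> e" "q \<in> f" for e f p q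
    using rw_sim_imp_same_edge(1)[OF augmented_configuration_17 simple_configuration_17]
      same_edge_unique[OF simple_configuration_17] that by metis
  moreover have "rw_sim ?G p q" if "e \<in> two_edges ?G" "p \<in> e" "q \<in> e" for e p q
  proof -
    obtain a b where "(a, b) \<in> set two_edges_17" "e = {a, b}"
      using \<open>e \<in> two_edges ?G\<close> by (auto simp: configuration_of_def)
    then have "rw_sim ?G a b" "e = {a, b}"
      using sim by auto
    then show ?thesis
      using that(2,3) sim_sym sim_refl rw_sim_occupied by (metis insertE singletonD)
  qed
  ultimately show ?thesis
    unfolding RW3_plus_admissible_def by blast
qed

section \<open>The values of the parameters\<close>

lemmas reducible_patterns = reducible_pattern1 reducible_pattern2 reducible_pattern3 reducible_pattern4 reducible_pattern5 reducible_pattern6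
  reducible_pattern7 reducible_pattern8 reducible_pattern9 reducible_pattern10 reducible_pattern11 reducible_pattern12 reducible_pattern13

lemma set_row_cells:
  assumes "length C = 5"
  shows "set (row_cells C) = cells_of_rows C"
proof -
  obtain a b c d e where C: "C = [a, b, c, d, e]"
    using assms by (auto simp: length_Suc_conv eval_nat_numeral)
  have "1 \<le> i \<and> i \<le> 5 \<longleftrightarrow> i = 1 \<or> i = 2 \<or> i = 3 \<or> i = 4 \<or> i = 5" for i :: nat
    by auto
  then have "cells_of_rows C = {(i, j). (i = 1 \<or> i = 2 \<or> i = 3 \<or> i = 4 \<or> i = 5) \<and> j \<in> set (C ! (i - 1))}"
    unfolding cells_of_rows_def assms by blast
  then show ?thesis
    unfolding row_cells_def C by auto
qed

lemma set_free_cells: "set (free_cells C) = cells 5 5 - set (row_cells C)"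
proof -
  have "{1..5} = set [1, 2, 3, 4, 5 :: nat]"
    by auto
  then show ?thesis
    unfolding free_cells_def cells_def by (simp only: set_filter set_product) auto
qed

lemma distinct_free_cells: "distinct (free_cells C)"
  unfolding free_cells_def by (intro distinct_filter distinct_product) simp_all

lemma distinct_concat_edges:
  assumes "distinct (concat P)" "[] \<notin> set P"
  shows "distinct (map set P)" "\<forall>p\<in>set P. distinct p"
proof -
  have "distinct (map set P) \<and> (\<forall>p\<in>set P. distinct p)"
    using assms
  proof (induction P)
    case (Cons p P)
    have "set p \<notin> set ` set P"
    proof
      assume "set p \<in> set ` set P"
      then have "set p \<subseteq> set (concat P)"
        by auto
      then show False
        using Cons.prems by (cases p) auto
    qed
    then show ?case
      using Cons by auto
  qed simp
  then show "distinct (map set P)" "\<forall>p\<in>set P. distinct p"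
    by blast+
qed

text \<open>Pulling the two-edges of \<open>G\<close> back along \<rho> and \<kappa> to the standard
  extremal set gives a valuation \<open>S\<close>, \<open>K\<close>. Irreducibility would make it
  satisfy all matching clauses.\<close>

lemma six_two_edges_not_irreducible:
  assumes G: "augmented_configuration 5 5 G" "simple_configuration G" "6 \<le> card (two_edges G)"
    and \<rho>: "bij_betw \<rho> {1..5} {1..5}" and \<kappa>: "bij_betw \<kappa> {1..5} {1..5}"
    and ones: "one_edges G = map_prod \<rho> \<kappa> ` set (row_cells C)" "card (one_edges G) = 12"
    and row_cells: "set (row_cells C) \<subseteq> cells 5 5"
    and table: "applicable_table C T" "\<forall>(P, m, n, ss)\<in>set T. reducible m n P"
    and no_matching: "\<And>S K. \<not> matching_clauses C T S K"
  shows "\<not> irreducible_configuration 5 5 G"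
proof
  assume irreducible: "irreducible_configuration 5 5 G"
  let ?g = "map_prod \<rho> \<kappa>" and ?U = "free_cells C"
  have g: "bij_betw ?g (cells 5 5) (cells 5 5)"
    unfolding cells_def using \<rho> \<kappa> by (rule bij_betw_map_prod)
  note g_inj = bij_betw_imp_inj_on[OF g] and g_surj = bij_betw_imp_surj_on[OF g]
  have U: "set ?U \<subseteq> cells 5 5"
    unfolding set_free_cells by blast
  define S where "S p \<longleftrightarrow> ?g ` set p \<in> two_edges G" for p
  define K where "K u \<longleftrightarrow> (\<exists>e\<in>two_edges G. ?g u \<in> e)" for u
  \<comment> \<open>By simplicity a two-edge through a cell of a one-edge would equal that
    singleton.\<close>
  have free: "e \<subseteq> ?g ` set ?U" if "e \<in> two_edges G" for e
  proof
    fix c assume c: "c \<in> e"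
    have "e \<subseteq> cells 5 5" "card e = 2"
      using G(1) that unfolding augmented_configuration_def by auto
    then have "c \<in> ?g ` cells 5 5"
      using c unfolding g_surj by blast
    then obtain d where d: "d \<in> cells 5 5" "c = ?g d"
      by (elim imageE)
    have "d \<notin> set (row_cells C)"
    proof
      assume "d \<in> set (row_cells C)"
      then have "{c} \<in> selected_edges G"
        using ones(1) d unfolding selected_edges_def by blast
      moreover have "e \<in> selected_edges G"
        using that unfolding selected_edges_def by blast
      ultimately have "{c} = e"
        using same_edge_unique[OF G(2)] c by blast
      then show False
        using \<open>card e = 2\<close> by auto
    qed
    then show "c \<in> ?g ` set ?U"
      using d unfolding set_free_cells by blast
  qed
  have doubleton: "\<exists>p\<in>set (pairs ?U). u \<in> set p \<and> ?g ` set p = e"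
    if e: "e \<in> two_edges G" "?g u \<in> e" and u: "u \<in> set ?U" for e u
  proof -
    have "card e = 2"
      using G(1) e(1) unfolding augmented_configuration_def by blast
    then obtain c where c: "e = {?g u, c}" "c \<noteq> ?g u"
      using e(2) by (metis card_2_iff doubleton_eq_iff insertE singletonD)
    then have "c \<in> ?g ` set ?U"
      using free[OF e(1)] by (simp only: insert_subset simp_thms)
    then obtain w where w: "w \<in> set ?U" "c = ?g w"
      by (elim imageE)
    then have "[u, w] \<in> set (pairs ?U) \<or> [w, u] \<in> set (pairs ?U)"
      using u c by (intro pairs_cover) auto
    moreover have "?g ` set [u, w] = e" "?g ` set [w, u] = e"
      by (simp_all add: c(1) w(2) insert_commute)
    moreover have "u \<in> set [u, w]" "u \<in> set [w, u]"
      by simp_all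
    ultimately show ?thesis
      by metis
  qed
  have K_iff: "K u \<longleftrightarrow> list_ex S (filter (\<lambda>p. u \<in> set p) (pairs ?U))" if "u \<in> set ?U" for u
    using doubleton[OF _ _ that] unfolding K_def S_def list_ex_iff by auto
  have pairwise: "\<not> list_all S ps"
    if u: "u \<in> set ?U" and ps: "ps \<in> set (pairs (filter (\<lambda>p. u \<in> set p) (pairs ?U)))" for u ps
  proof
    assume "list_all S ps"
    obtain p q where pq: "ps = [p, q]" "p \<noteq> q" "p \<in> set (pairs ?U)" "q \<in> set (pairs ?U)" "u \<in> set p" "u \<in> set q"
      using in_pairsD[OF ps] distinct_pairs[OF distinct_free_cells] by auto
    then have "set p \<noteq> set q"
      using inj_on_set_pairs[OF distinct_free_cells] by (meson inj_onD)
    moreover have "set p \<subseteq> set ?U" "set q \<subseteq> set ?U"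
      using pq pairs_elements[of _ ?U] by fastforce+
    ultimately have "?g ` set p \<noteq> ?g ` set q"
      using inj_on_image_eq_iff[OF g_inj] U by (meson order_trans)
    have selected: "?g ` set p \<in> selected_edges G" "?g ` set q \<in> selected_edges G"
      using \<open>list_all S ps\<close> pq(1) unfolding S_def selected_edges_def by auto
    have common: "?g u \<in> ?g ` set p" "?g u \<in> ?g ` set q"
      using pq by auto
    show False
      using same_edge_unique[OF G(2) selected common] \<open>?g ` set p \<noteq> ?g ` set q\<close> by contradiction
  qed
  \<comment> \<open>If two free cells were uncovered, at least 12 cells of disjoint two-edges would
    have to fit into the other 11.\<close>
  have cover: "K u \<or> K w" if "u \<in> set ?U" "w \<in> set ?U" "u \<noteq> w" for u w
  proof (rule ccontr)
    assume uncovered: "\<not> ?thesis"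
    have "\<Union> (two_edges G) \<subseteq> ?g ` (set ?U - {u, w})"
    proof
      fix c assume "c \<in> \<Union> (two_edges G)"
      then obtain e where e: "e \<in> two_edges G" "c \<in> e"
        by blast
      then have "c \<in> ?g ` set ?U"
        using free by blast
      then obtain d where d: "c = ?g d" "d \<in> set ?U"
        by (elim imageE)
      moreover have "d \<noteq> u" "d \<noteq> w"
        using uncovered e d(1) unfolding K_def by blast+
      ultimately show "c \<in> ?g ` (set ?U - {u, w})"
        by simp
    qed
    then have "card (\<Union> (two_edges G)) \<le> card (?g ` (set ?U - {u, w}))"
      by (intro card_mono) auto
    also have "\<dots> \<le> card (set ?U - {u, w})"
      by (rule card_image_le) simp
    also have "\<dots> = card (set ?U) - 2"
      using that by (simp add: card_Diff_subset)
    also have "card (set ?U) = 13"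
    proof -
      have "card (set (row_cells C)) = 12"
        using ones card_image[OF inj_on_subset[OF g_inj row_cells]] by simp
      then show ?thesis
        unfolding set_free_cells using row_cells
        by (simp add: card_Diff_subset cells_def card_cartesian_product)
    qed
    finally have "card (\<Union> (two_edges G)) \<le> 11"
      by simp
    moreover have "card (\<Union> (two_edges G)) = (\<Sum>e\<in>two_edges G. card e)"
    proof (rule card_Union_disjoint)
      show "pairwise disjnt (two_edges G)"
        using G(2) unfolding simple_configuration_def selected_edges_def pairwise_def disjnt_def by blast
      show "finite e" if "e \<in> two_edges G" for e
        using selected_edge_cells(1)[OF G(1)] that unfolding selected_edges_def by blast
    qed
    moreover have "\<dots> = 2 * card (two_edges G)"
      using G(1) unfolding augmented_configuration_def by simp
    ultimately show False
      using G(3) by simp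
  qed
  \<comment> \<open>Once its two-edges are selected, the placed pattern moved by \<open>?g\<close>
    is a reducible family of selected edges.\<close>
  have avoid: "\<not> list_all S (map sorted_edge (filter (\<lambda>p. length p = 2) Q))" if Q: "Q \<in> set (placed_patterns T)" for Q
  proof
    assume all: "list_all S (map sorted_edge (filter (\<lambda>p. length p = 2) Q))"
    have "valid_table T" and Q_distinct: "distinct (concat Q)"
      and Q_edges: "\<And>p. p \<in> set Q \<Longrightarrow> length p = 2 \<and> set p \<subseteq> set ?U \<or> length p = 1 \<and> hd p \<in> set (row_cells C)"
      using table(1) Q unfolding applicable_table_def list_all_iff by auto
    then have "reducible 5 5 Q"
      using table(2) Q by (intro reducible_placed_patterns)
    then have reducible: "reducible 5 5 (map (map ?g) Q)"
      using \<rho> \<kappa> by (intro reducible_map) (auto simp: bij_betw_def)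
    have selected: "?g ` set p \<in> selected_edges G" if "p \<in> set Q" for p
      using Q_edges[OF that]
    proof
      assume "length p = 2 \<and> set p \<subseteq> set ?U"
      then have "S (sorted_edge p)"
        using all that unfolding list_all_iff by auto
      then show ?thesis
        unfolding S_def selected_edges_def by simp
    next
      assume "length p = 1 \<and> hd p \<in> set (row_cells C)"
      then obtain c where "p = [c]" "c \<in> set (row_cells C)"
        by (cases p) auto
      then show ?thesis
        using ones(1) unfolding selected_edges_def by simp
    qed
    have Q_cells: "set (concat Q) \<subseteq> cells 5 5"
    proof -
      have "set p \<subseteq> cells 5 5" if "p \<in> set Q" for p
        using Q_edges[OF that] row_cells U by (cases p) auto
      then show ?thesis
        by auto
    qed
    have "distinct (concat (map (map ?g) Q))"
      using Q_distinct g_inj Q_cells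
      by (simp add: map_concat[symmetric] distinct_map inj_on_subset)
    moreover have "[] \<notin> set (map (map ?g) Q)"
      using Q_edges by fastforce
    ultimately have "distinct (map set (map (map ?g) Q))" "\<forall>p\<in>set (map (map ?g) Q). distinct p"
      by (rule distinct_concat_edges)+
    then show False
      using reducible_imp_not_irreducible[OF G(1) reducible] selected irreducible by auto
  qed
  have "list_all (\<lambda>p. K (p ! 0) \<or> K (p ! 1)) (pairs ?U)"
  proof (intro list_all_iff[THEN iffD2] ballI)
    fix p assume "p \<in> set (pairs ?U)"
    then obtain u w where "p = [u, w]" "u \<noteq> w" "u \<in> set ?U" "w \<in> set ?U"
      using in_pairsD distinct_free_cells by blast
    then show "K (p ! 0) \<or> K (p ! 1)"
      using cover by simp
  qed
  moreover have "list_all (\<lambda>u. K u \<longleftrightarrow> list_ex S (filter (\<lambda>p. u \<in> set p) (pairs ?U))) ?U"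
    by (intro list_all_iff[THEN iffD2] ballI K_iff)
  moreover have "list_all (\<lambda>u. list_all (\<lambda>ps. \<not> list_all S ps) (pairs (filter (\<lambda>p. u \<in> set p) (pairs ?U)))) ?U"
    by (intro list_all_iff[THEN iffD2] ballI pairwise)
  moreover have "list_all (\<lambda>ps. \<not> list_all S ps)
      (map (\<lambda>P. map sorted_edge (filter (\<lambda>p. length p = 2) P)) (placed_patterns T))"
    (is "list_all _ ?clauses")
  proof (intro list_all_iff[THEN iffD2] ballI)
    fix ps assume "ps \<in> set ?clauses"
    then show "\<not> list_all S ps"
      unfolding set_map by (elim imageE) (simp only: avoid not_False_eq_True)
  qed
  ultimately have "matching_clauses C T S K"
    unfolding matching_clauses_def by (intro conjI)
  with no_matching show False
    by blast
qed

text \<open>\<open>Max\<close> is meaningful on finite nonempty sets; the upper bound supplies the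
  finiteness.\<close>

lemma Max_nat_eqI:
  fixes A :: "nat set"
  assumes "\<And>a. a \<in> A \<Longrightarrow> a \<le> k" "k \<in> A"
  shows "Max A = k"
proof (rule Max_eqI)
  show "finite A"
    using assms(1) finite_nat_set_iff_bounded_le by blast
qed (use assms in auto)

lemma zarankiewicz_5_5: "zarankiewicz 5 5 = 12"
  unfolding zarankiewicz_def
proof (rule Max_nat_eqI)
  fix a assume "a \<in> {card E | E. E \<subseteq> cells 5 5 \<and> C4_free E}"
  then obtain E where "a = card E" "E \<subseteq> cells 5 5" "C4_free E"
    by blast
  then show "a \<le> 12"
    using card_C4_free_5_5 by simp
next
  have "card (one_edges configuration_17) = 12"
    unfolding one_edges_configuration_17 by simp
  moreover have "one_edges configuration_17 \<subseteq> cells 5 5"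
    using augmented_configuration_17 unfolding augmented_configuration_def by blast
  ultimately show "12 \<in> {card E | E. E \<subseteq> cells 5 5 \<and> C4_free E}"
    using C4_free_configuration_17 by (intro CollectI exI[of _ "one_edges configuration_17"]) simp
qed

lemma num_squares_le_17:
  assumes G: "limited_configuration 5 5 G" "irreducible_configuration 5 5 G"
  shows "num_squares G \<le> 17"
proof (rule ccontr)
  assume "\<not> ?thesis"
  have aug: "augmented_configuration 5 5 G" and simple: "simple_configuration G"
    and ones: "C4_free (one_edges G)" "card (one_edges G) = 12" "one_edges G \<subseteq> cells 5 5"
    using G(1) unfolding limited_configuration_def zarankiewicz_5_5 augmented_configuration_def by blast+
  then have six: "6 \<le> card (two_edges G)"
    using \<open>\<not> num_squares G \<le> 17\<close> unfolding num_squares_def by simp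
  obtain C \<rho> \<kappa> where C: "C = rows_A \<or> C = rows_B"
    and bij: "bij_betw \<rho> {1..5} {1..5}" "bij_betw \<kappa> {1..5} {1..5}"
    and one_edges: "one_edges G = map_prod \<rho> \<kappa> ` cells_of_rows C"
    using extremal_C4_free_5_5[OF ones(3,1,2)] .
  have "length C = 5"
    using C by (auto simp: rows_A_def rows_B_def)
  then have one_edges': "one_edges G = map_prod \<rho> \<kappa> ` set (row_cells C)"
    using one_edges by (simp add: set_row_cells)
  note not_irreducible = six_two_edges_not_irreducible[OF aug simple six bij one_edges' ones(2)]
  from C show False
  proof
    assume C: "C = rows_A"
    have "set (row_cells C) \<subseteq> cells 5 5"
      unfolding C by (simp add: row_cells_def rows_A_def cells_def)
    moreover have "\<forall>(P, m, n, ss)\<in>set table_A. reducible m n P"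
      by (simp add: table_A_def reducible_patterns)
    ultimately show False
      using not_irreducible[of table_A] applicable_table_A no_matching_A G(2) unfolding C by blast
  next
    assume C: "C = rows_B"
    have "set (row_cells C) \<subseteq> cells 5 5"
      unfolding C by (simp add: row_cells_def rows_B_def cells_def)
    moreover have "\<forall>(P, m, n, ss)\<in>set table_B. reducible m n P"
      by (simp add: table_B_def base_table_B_def reducible_patterns)
    ultimately show False
      using not_irreducible[of table_B] applicable_table_B no_matching_B G(2) unfolding C by blast
  qed
qed

lemma limited_configuration_17: "limited_configuration 5 5 configuration_17"
  unfolding limited_configuration_def zarankiewicz_5_5
  using augmented_configuration_17 simple_configuration_17 C4_free_configuration_17
  unfolding one_edges_configuration_17 by simp

lemma irreducible_configuration_17: "irreducible_configuration 5 5 configuration_17"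
  by (rule admissible_imp_irreducible[OF augmented_configuration_17 simple_configuration_17
        admissible_configuration_17])

lemma Max_num_squares_eq_17:
  assumes "\<And>G. Q G \<Longrightarrow> num_squares G \<le> 17" "Q configuration_17"
  shows "Max {num_squares G | G. Q G} = 17"
proof (rule Max_nat_eqI)
  fix a assume "a \<in> {num_squares G | G. Q G}"
  then obtain G where "a = num_squares G" "Q G"
    by blast
  then show "a \<le> 17"
    using assms(1) by simp
next
  show "17 \<in> {num_squares G | G. Q G}"
    using assms(2) num_squares_configuration_17 by (intro CollectI exI[of _ configuration_17]) simp
qed

lemma z2_5_5: "z2 5 5 = 17"
  unfolding z2_def
  using num_squares_le_17 limited_configuration_17 irreducible_configuration_17
  by (intro Max_num_squares_eq_17) blast+

lemma z_RL_5_5: "z_RL 5 5 = 17"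
  unfolding z_RL_def
proof (rule Max_num_squares_eq_17)
  fix G assume "limited_configuration 5 5 G \<and> RW3_plus_admissible G"
  then show "num_squares G \<le> 17"
    using num_squares_le_17 admissible_imp_irreducible unfolding limited_configuration_def by blast
next
  show "limited_configuration 5 5 configuration_17 \<and> RW3_plus_admissible configuration_17"
    using limited_configuration_17 admissible_configuration_17 ..
qed

theorem theorem5p5:
  shows "z2 5 5 = 17 \<and>
         (\<forall>z_SL :: int. int (z2 5 5) \<ge> z_SL \<and> z_SL \<ge> int (z_RL 5 5) \<longrightarrow> z_SL = 17) \<and>
         z_RL 5 5 = 17"
  by (simp add: z2_5_5 z_RL_5_5)

end
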